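(* Let $\mathbb{K}$ be an algebraically closed field of prime characteristic $p\ge 7$, and let $m$ be an integer with $5\le m\le p-1$. Let $V$ be the irreducible non-singular curve in $\mathrm{PG}(m-1,\mathbb{K})$ defined by the equations $X_1^k+\cdots+X_m^k=0$ for $1\le k\le m-2$, regarded as a curve in the hyperplane $X_1+\cdots+X_m=0$, which is identified with $\mathrm{PG}(m-2,\mathbb{K})$. If $\mathrm{Aut}(V)$ contains some non-tame projectivity, then $m=p-1$ and the linear subgroup $L\mathrm{Aut}(V)$ of $\mathrm{Aut}(V)$ is isomorphic to the symmetric group $\mathrm{Sym}_p$.
   Context: $\mathrm{Aut}(V)$ is the group of automorphisms of $V$ over $\mathbb{K}$. The linear subgroup $L\mathrm{Aut}(V)$ is the subgroup of $\mathrm{Aut}(V)$ consisting of those automorphisms that are induced by projectivities (elements of $\mathrm{PGL}(m-1,\mathbb{K})$) of $\mathrm{PG}(m-2,\mathbb{K})$ preserving $V$. A finite automorphism group is tame if $p$ does not divide its order; a non-tame projectivity is one generating a non-tame group, i.e. one whose order is divisible by $p$. *)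

theory Defs
  imports "HOL-Analysis.Analysis" "HOL-Algebra.Sym_Groups" "HOL-Algebra.Bij"
begin

section \<open>Projective spaces, projectivities and regular maps\<close>

text \<open>The projective space of a subspace \<open>W\<close> of \<open>K\<^sup>n\<close>: a point is a line through the origin, as a
  set of vectors.\<close>

definition PG :: "('k::field ^ 'n) set \<Rightarrow> ('k ^ 'n) set set" where
  "PG W = {vec.span {v} | v. v \<in> W \<and> v \<noteq> 0}"

text \<open>Every linear automorphism of \<open>W\<close> extends to a linear endomorphism of the ambient space, so that
  the following are all the elements of \<open>PGL(W)\<close>, as permutations of the points of \<open>PG W\<close>.\<close>

definition projectivities :: "('k::field ^ 'n) set \<Rightarrow> (('k ^ 'n) set \<Rightarrow> ('k ^ 'n) set) set" where
  "projectivities W =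
     {\<lambda>P\<in>PG W. f ` P | f. Vector_Spaces.linear (*s) (*s) f \<and> bij_betw f W W}"

text \<open>Functions given by a homogeneous polynomial of degree \<open>d\<close> in the coordinates (or by the zero
  polynomial).  Over an infinite field, functions and polynomials can be identified.\<close>

inductive form :: "nat \<Rightarrow> ('k::field ^ 'n \<Rightarrow> 'k) \<Rightarrow> bool" where
  const: "form 0 (\<lambda>_. c)"
| coord: "form 1 (\<lambda>x. x $ i)"
| add: "form d f \<Longrightarrow> form d g \<Longrightarrow> form d (\<lambda>x. f x + g x)"
| mult: "form d f \<Longrightarrow> form e g \<Longrightarrow> form (d + e) (\<lambda>x. f x * g x)"

text \<open>Regular self-maps of a projective algebraic set: near every point the map is given by forms of
  equal degree.  Multiplying these by a form that does not vanish at the point shrinks the set where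
  they do not all vanish, so there is no need to mention a smaller Zariski-open neighbourhood.\<close>

definition regular_map :: "('k::field ^ 'n) set set \<Rightarrow> (('k ^ 'n) set \<Rightarrow> ('k ^ 'n) set) \<Rightarrow> bool" where
  "regular_map V \<phi> \<longleftrightarrow> \<phi> \<in> V \<rightarrow> V \<and>
     (\<forall>P\<in>V. \<exists>d F. (\<forall>i. form d (\<lambda>x. F x $ i)) \<and> (\<exists>v\<in>P. F v \<noteq> 0) \<and>
        (\<forall>Q\<in>V. \<forall>v\<in>Q. F v \<noteq> 0 \<longrightarrow> \<phi> Q = vec.span {F v}))"

definition Aut :: "('k::field ^ 'n) set set \<Rightarrow> (('k ^ 'n) set \<Rightarrow> ('k ^ 'n) set) monoid" where
  "Aut V = BijGroup V
     \<lparr>carrier := {\<phi> \<in> Bij V. regular_map V \<phi> \<and> regular_map V (inv_into V \<phi>)}\<rparr>"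

text \<open>The automorphisms of \<open>V \<subseteq> PG W\<close> that are induced by projectivities of \<open>PG W\<close>.\<close>

definition LAut ::
    "('k::field ^ 'n) set \<Rightarrow> ('k ^ 'n) set set \<Rightarrow> (('k ^ 'n) set \<Rightarrow> ('k ^ 'n) set) monoid" where
  "LAut W V = Aut V
     \<lparr>carrier := {\<phi> \<in> carrier (Aut V). \<exists>g \<in> projectivities W. \<forall>P\<in>V. \<phi> P = g P}\<rparr>"

text \<open>An element is non-tame if the subgroup it generates is finite of order divisible by \<open>p\<close>.
  Finiteness has to be required, since \<open>card\<close> is \<open>0\<close> on infinite sets.\<close>

definition nontame :: "nat \<Rightarrow> 'a monoid \<Rightarrow> 'a \<Rightarrow> bool" where
  "nontame p G x \<longleftrightarrow> finite (generate G {x}) \<and> p dvd card (generate G {x})"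


section \<open>\<open>Aut V\<close> and \<open>LAut W V\<close> are groups\<close>

lemma form_scale: "form d f \<Longrightarrow> f (c *s x) = c ^ d * f x"
  by (induction rule: form.induct) (auto simp: algebra_simps power_add)

lemma form_compose:
  assumes "form e g" "\<And>i. form d (\<lambda>x. F x $ i)"
  shows "form (e * d) (\<lambda>x. g (F x))"
  using assms(1)
proof induction
  case (const c)
  show ?case by (simp add: form.const)
next
  case (coord i)
  show ?case using assms(2) by simp
next
  case (add e f g)
  then show ?case by (intro form.add)
next
  case (mult e f e' g)
  then show ?case by (simp add: add_mult_distrib form.mult)
qed

lemma in_PG_span:
  fixes v :: "'k::field ^ 'n"
  assumes "P \<in> PG W" "v \<in> P" "v \<noteq> 0"
  shows "P = vec.span {v}"
proof -
  obtain u where P: "P = vec.span {u}" using assms(1) by (auto simp: PG_def)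
  then obtain c where c: "v = c *s u" using assms(2) by (auto simp: vec.span_singleton)
  then have "c \<noteq> 0" using assms(3) by auto
  then have "u = inverse c *s v" by (simp add: c)
  then have "u \<in> vec.span {v}" by (auto simp: vec.span_singleton)
  then show ?thesis
    using assms(2) vec.span_minimal[of "{u}" "vec.span {v}"] vec.span_minimal[of "{v}" P]
    by (simp add: P)
qed

lemma zero_in_PG: "P \<in> PG W \<Longrightarrow> 0 \<in> P"
  unfolding PG_def by (auto simp: vec.span_zero)

lemma regular_map_compose:
  fixes V :: "('k::field ^ 'n) set set"
  assumes V: "V \<subseteq> PG UNIV" and \<phi>: "regular_map V \<phi>" and \<psi>: "regular_map V \<psi>"
  shows "regular_map V (compose V \<psi> \<phi>)"
  unfolding regular_map_def
proof (intro conjI ballI)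
  show "compose V \<psi> \<phi> \<in> V \<rightarrow> V"
    using \<phi> \<psi> by (auto simp: regular_map_def compose_def)
next
  fix P assume P: "P \<in> V"
  have \<phi>V: "\<phi> Q \<in> V" if "Q \<in> V" for Q using \<phi> that by (auto simp: regular_map_def)
  obtain d F where F: "\<And>i. form d (\<lambda>x. F x $ i)" "\<exists>v\<in>P. F v \<noteq> 0"
      "\<And>Q v. Q \<in> V \<Longrightarrow> v \<in> Q \<Longrightarrow> F v \<noteq> 0 \<Longrightarrow> \<phi> Q = vec.span {F v}"
    using \<phi> P unfolding regular_map_def by metis
  obtain e G where G: "\<And>i. form e (\<lambda>x. G x $ i)" "\<exists>v\<in>\<phi> P. G v \<noteq> 0"
      "\<And>Q v. Q \<in> V \<Longrightarrow> v \<in> Q \<Longrightarrow> G v \<noteq> 0 \<Longrightarrow> \<psi> Q = vec.span {G v}"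
    using \<psi> \<phi>V[OF P] unfolding regular_map_def by metis
  obtain v where v: "v \<in> P" "F v \<noteq> 0" using F(2) by blast
  obtain w where w: "w \<in> \<phi> P" "G w \<noteq> 0" using G(2) by blast
  obtain c where c: "w = c *s F v"
    using w(1) F(3)[OF P v] by (auto simp: vec.span_singleton)
  have "G w = c ^ e *s G (F v)"
    unfolding c vec_eq_iff using form_scale[OF G(1)] by simp
  then have GF: "G (F v) \<noteq> 0" using w(2) by auto
  show "\<exists>d F. (\<forall>i. form d (\<lambda>x. F x $ i)) \<and> (\<exists>v\<in>P. F v \<noteq> 0) \<and>
        (\<forall>Q\<in>V. \<forall>v\<in>Q. F v \<noteq> 0 \<longrightarrow> compose V \<psi> \<phi> Q = vec.span {F v})"
  proof (intro exI[of _ "e * d"] exI[of _ "\<lambda>x. G (F x)"] conjI allI ballI impI)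
    show "form (e * d) (\<lambda>x. G (F x) $ i)" for i
      using form_compose[OF G(1) F(1)] .
    show "\<exists>v\<in>P. G (F v) \<noteq> 0" using v(1) GF by blast
    fix Q u assume Q: "Q \<in> V" "u \<in> Q" "G (F u) \<noteq> 0"
    have "F u \<in> \<phi> Q"
    proof (cases "F u = 0")
      case True
      then show ?thesis using \<phi>V[OF Q(1)] V zero_in_PG by auto
    next
      case False
      then show ?thesis using F(3)[OF Q(1,2)] by (simp add: vec.span_base)
    qed
    then show "compose V \<psi> \<phi> Q = vec.span {G (F u)}"
      using G(3)[OF \<phi>V[OF Q(1)] _ Q(3)] Q(1) by (simp add: compose_def)
  qed
qed

lemma regular_map_cong:
  "(\<And>P. P \<in> V \<Longrightarrow> \<phi> P = \<psi> P) \<Longrightarrow> regular_map V \<phi> \<longleftrightarrow> regular_map V \<psi>"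
  unfolding regular_map_def by (simp add: Pi_iff cong: ball_cong)

lemma regular_map_id:
  fixes V :: "('k::field ^ 'n) set set"
  assumes V: "V \<subseteq> PG UNIV"
  shows "regular_map V (\<lambda>P\<in>V. P)"
  unfolding regular_map_def
proof (intro conjI ballI)
  fix P assume P: "P \<in> V"
  obtain v where v: "v \<in> P" "v \<noteq> 0"
    using P V unfolding PG_def by (blast intro: vec.span_base)
  show "\<exists>d F. (\<forall>i. form d (\<lambda>x. F x $ i)) \<and> (\<exists>v\<in>P. F v \<noteq> 0) \<and>
        (\<forall>Q\<in>V. \<forall>v\<in>Q. F v \<noteq> 0 \<longrightarrow> (\<lambda>P\<in>V. P) Q = vec.span {F v})"
    by (rule exI[of _ 1], rule exI[of _ "\<lambda>x. x"])
       (use v V in \<open>auto intro: form.coord[unfolded One_nat_def] simp: in_PG_span[OF subsetD[OF V]]\<close>)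
qed auto

lemma subgroup_Aut:
  fixes V :: "('k::field ^ 'n) set set"
  assumes V: "V \<subseteq> PG UNIV"
  shows "subgroup (carrier (Aut V)) (BijGroup V)"
proof (rule group.subgroupI[OF group_BijGroup])
  show "carrier (Aut V) \<subseteq> carrier (BijGroup V)"
    by (auto simp: Aut_def BijGroup_def)
  have "inv_into V (\<lambda>P\<in>V. P) P = P" if "P \<in> V" for P
    using that by (intro inv_into_f_eq) (auto simp: inj_on_def)
  then have "regular_map V (inv_into V (\<lambda>P\<in>V. P))"
    using regular_map_cong[of V "inv_into V (\<lambda>P\<in>V. P)" "\<lambda>P\<in>V. P"] regular_map_id[OF V] by simp
  then have "(\<lambda>P\<in>V. P) \<in> carrier (Aut V)"
    using regular_map_id[OF V] by (auto simp: Aut_def id_Bij)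
  then show "carrier (Aut V) \<noteq> {}" by blast
next
  fix \<phi> assume "\<phi> \<in> carrier (Aut V)"
  then have \<phi>: "\<phi> \<in> Bij V" "regular_map V \<phi>" "regular_map V (inv_into V \<phi>)"
    by (auto simp: Aut_def)
  let ?\<psi> = "\<lambda>P\<in>V. inv_into V \<phi> P"
  have \<psi>: "?\<psi> \<in> Bij V" using \<phi>(1) by (rule restrict_inv_into_Bij)
  have "inv_into V ?\<psi> P = \<phi> P" if P: "P \<in> V" for P
  proof (rule inv_into_f_eq)
    show "inj_on ?\<psi> V" using \<psi> by (auto simp: Bij_def bij_betw_def)
    show *: "\<phi> P \<in> V" using \<phi>(1) P Bij_imp_funcset by blast
    show "?\<psi> (\<phi> P) = P"
      using * P \<phi>(1) by (auto simp: Bij_def bij_betw_def)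
  qed
  then have "regular_map V (inv_into V ?\<psi>)"
    using regular_map_cong[of V "inv_into V ?\<psi>" \<phi>] \<phi>(2) by simp
  moreover have "regular_map V ?\<psi>"
    using regular_map_cong[of V ?\<psi> "inv_into V \<phi>"] \<phi>(3) by simp
  ultimately show "inv\<^bsub>BijGroup V\<^esub> \<phi> \<in> carrier (Aut V)"
    using \<phi>(1) \<psi> by (auto simp: Aut_def inv_BijGroup)
next
  fix \<phi> \<psi> assume "\<phi> \<in> carrier (Aut V)" "\<psi> \<in> carrier (Aut V)"
  then have \<phi>: "\<phi> \<in> Bij V" "regular_map V \<phi>" "regular_map V (inv_into V \<phi>)"
    and \<psi>: "\<psi> \<in> Bij V" "regular_map V \<psi>" "regular_map V (inv_into V \<psi>)"
    by (auto simp: Aut_def)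
  have comp: "compose V \<phi> \<psi> \<in> Bij V" using \<phi>(1) \<psi>(1) by (rule compose_Bij)
  have "inv_into V (compose V \<phi> \<psi>) P = compose V (inv_into V \<psi>) (inv_into V \<phi>) P"
    if P: "P \<in> V" for P
  proof (rule inv_into_f_eq)
    show "inj_on (compose V \<phi> \<psi>) V" using comp by (auto simp: Bij_def bij_betw_def)
    have 1: "\<phi> ` V = V" "\<psi> ` V = V" using \<phi>(1) \<psi>(1) by (auto simp: Bij_def bij_betw_def)
    have 2: "inv_into V \<phi> P \<in> V" by (rule inv_into_into) (simp add: 1 P)
    show 3: "compose V (inv_into V \<psi>) (inv_into V \<phi>) P \<in> V"
      using P 2 by (simp add: compose_def) (rule inv_into_into, simp add: 1)
    show "compose V \<phi> \<psi> (compose V (inv_into V \<psi>) (inv_into V \<phi>) P) = P"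
      using P 2 3 1 by (simp add: compose_def f_inv_into_f)
  qed
  then have "regular_map V (inv_into V (compose V \<phi> \<psi>))"
    using regular_map_cong[of V "inv_into V (compose V \<phi> \<psi>)" "compose V (inv_into V \<psi>) (inv_into V \<phi>)"]
      regular_map_compose[OF V \<phi>(3) \<psi>(3)] by simp
  then show "\<phi> \<otimes>\<^bsub>BijGroup V\<^esub> \<psi> \<in> carrier (Aut V)"
    using comp \<phi>(1) \<psi>(1) regular_map_compose[OF V \<psi>(2) \<phi>(2)] by (auto simp: Aut_def BijGroup_def)
qed

lemma group_Aut: "V \<subseteq> PG UNIV \<Longrightarrow> group (Aut V)"
  using subgroup.subgroup_is_group[OF subgroup_Aut group_BijGroup]
  by (auto simp: Aut_def)

lemma bij_betw_linear_inverse: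
  fixes W :: "('k::field ^ 'n) set"
  assumes W: "vec.subspace W" and f: "Vector_Spaces.linear (*s) (*s) f" "bij_betw f W W"
  obtains h where "Vector_Spaces.linear (*s) (*s) h" "bij_betw h W W" "\<And>x. x \<in> W \<Longrightarrow> h (f x) = x"
proof -
  obtain h where h: "Vector_Spaces.linear (*s) (*s) h" "\<And>x. x \<in> W \<Longrightarrow> h (f x) = x"
    using vec.linear_exists_left_inverse_on[OF f(1) W] f(2) by (auto simp: bij_betw_def)
  have "bij_betw h W W"
  proof (rule bij_betw_byWitness[where f' = f])
    have fW: "f ` W = W" using f(2) by (simp add: bij_betw_def)
    have "f (h y) = y \<and> h y \<in> W" if "y \<in> W" for y
    proof -
      have "y \<in> f ` W" using that fW by simp
      then obtain x where "x \<in> W" "y = f x" by blast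
      with h(2) show ?thesis by simp
    qed
    then show "\<forall>x\<in>W. f (h x) = x" "h ` W \<subseteq> W" by blast+
    show "\<forall>x\<in>W. h (f x) = x" using h(2) by blast
    show "f ` W \<subseteq> W" using fW by (rule equalityD1)
  qed
  with h that show ?thesis by blast
qed

lemma subgroup_LAut:
  fixes W :: "('k::field ^ 'n) set"
  assumes W: "vec.subspace W" and V: "V \<subseteq> PG W"
  shows "subgroup (carrier (LAut W V)) (Aut V)"
proof -
  have V': "V \<subseteq> PG UNIV" using V by (auto simp: PG_def)
  have sub: "P \<subseteq> W" if "P \<in> V" for P
  proof -
    obtain v where "P = vec.span {v}" "v \<in> W" using V \<open>P \<in> V\<close> by (auto simp: PG_def)
    then show ?thesis using vec.span_minimal[of "{v}" W] W by simp
  qed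
  have proj: "(\<exists>g\<in>projectivities W. \<forall>P\<in>V. \<phi> P = g P) \<longleftrightarrow>
      (\<exists>f. Vector_Spaces.linear (*s) (*s) f \<and> bij_betw f W W \<and> (\<forall>P\<in>V. \<phi> P = f ` P))" for \<phi>
  proof -
    have "(\<lambda>P\<in>PG W. f ` P) P = f ` P" if "P \<in> V" for P and f :: "'k ^ 'n \<Rightarrow> 'k ^ 'n"
      using that V by auto
    then have "(\<forall>P\<in>V. \<phi> P = (\<lambda>P\<in>PG W. f ` P) P) \<longleftrightarrow> (\<forall>P\<in>V. \<phi> P = f ` P)"
      for f :: "'k ^ 'n \<Rightarrow> 'k ^ 'n" by (metis (no_types, lifting))
    then show ?thesis unfolding projectivities_def Bex_def mem_Collect_eq by metis
  qed
  interpret A: group "Aut V" by (rule group_Aut[OF V'])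
  interpret B: group "BijGroup V" by (rule group_BijGroup)
  have Bij: "\<phi> \<in> Bij V" if "\<phi> \<in> carrier (Aut V)" for \<phi>
    using that by (simp add: Aut_def)
  have one: "\<one>\<^bsub>Aut V\<^esub> = (\<lambda>P\<in>V. P)" by (simp add: Aut_def BijGroup_def)
  have mult: "\<phi> \<otimes>\<^bsub>Aut V\<^esub> \<psi> = compose V \<phi> \<psi>"
    if "\<phi> \<in> carrier (Aut V)" "\<psi> \<in> carrier (Aut V)" for \<phi> \<psi>
    using Bij[OF that(1)] Bij[OF that(2)] by (simp add: Aut_def BijGroup_def)
  show ?thesis
  proof (rule A.subgroupI)
    show "carrier (LAut W V) \<subseteq> carrier (Aut V)" by (auto simp: LAut_def)
    have "Vector_Spaces.linear (*s) (*s) (\<lambda>x::'k^'n. x)" by (rule vec.linear_ident)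
    then have "\<one>\<^bsub>Aut V\<^esub> \<in> carrier (LAut W V)"
      using A.one_closed bij_betw_id[of W] unfolding LAut_def one
      by (auto simp: proj id_def intro!: exI[where x = "\<lambda>x. x"])
    then show "carrier (LAut W V) \<noteq> {}" by blast
  next
    fix \<phi> assume "\<phi> \<in> carrier (LAut W V)"
    then obtain f where \<phi>: "\<phi> \<in> carrier (Aut V)" and f: "Vector_Spaces.linear (*s) (*s) f"
        "bij_betw f W W" "\<And>P. P \<in> V \<Longrightarrow> \<phi> P = f ` P"
      by (auto simp: LAut_def proj)
    obtain h where h: "Vector_Spaces.linear (*s) (*s) h" "bij_betw h W W"
        "\<And>x. x \<in> W \<Longrightarrow> h (f x) = x"
      using bij_betw_linear_inverse[OF W f(1,2)] by metis
    let ?\<psi> = "inv\<^bsub>Aut V\<^esub> \<phi>"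
    have \<psi>: "?\<psi> \<in> carrier (Aut V)" using \<phi> by simp
    have "?\<psi> P = h ` P" if P: "P \<in> V" for P
    proof -
      have Q: "?\<psi> P \<in> V" using Bij_imp_funcset[OF Bij[OF \<psi>]] P by blast
      have "compose V \<phi> ?\<psi> P = P"
        unfolding mult[OF \<phi> \<psi>, symmetric] A.r_inv[OF \<phi>] one using P by simp
      then have "f ` ?\<psi> P = P" using P f(3)[OF Q] by (simp add: compose_def)
      moreover have "h ` f ` ?\<psi> P = ?\<psi> P"
        unfolding image_image using h(3) subsetD[OF sub[OF Q]] by simp
      ultimately show ?thesis by simp
    qed
    then show "?\<psi> \<in> carrier (LAut W V)"
      using \<psi> h(1,2) by (auto simp: LAut_def proj)
  next
    fix \<phi> \<psi> assume "\<phi> \<in> carrier (LAut W V)" "\<psi> \<in> carrier (LAut W V)"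
    then obtain f h where \<phi>: "\<phi> \<in> carrier (Aut V)" and f: "Vector_Spaces.linear (*s) (*s) f"
        "bij_betw f W W" "\<And>P. P \<in> V \<Longrightarrow> \<phi> P = f ` P"
      and \<psi>: "\<psi> \<in> carrier (Aut V)" and h: "Vector_Spaces.linear (*s) (*s) h"
        "bij_betw h W W" "\<And>P. P \<in> V \<Longrightarrow> \<psi> P = h ` P"
      by (auto simp: LAut_def proj)
    have "(\<phi> \<otimes>\<^bsub>Aut V\<^esub> \<psi>) P = (f \<circ> h) ` P" if P: "P \<in> V" for P
    proof -
      have "\<psi> P \<in> V" using Bij_imp_funcset[OF Bij[OF \<psi>]] P by blast
      then show ?thesis
        using P f(3) h(3) by (simp add: mult[OF \<phi> \<psi>] compose_def image_comp)
    qed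
    moreover have "Vector_Spaces.linear (*s) (*s) (f \<circ> h)"
      by (rule Vector_Spaces.linear_compose[OF h(1) f(1)])
    moreover have "bij_betw (f \<circ> h) W W" by (rule bij_betw_trans[OF h(2) f(2)])
    ultimately show "\<phi> \<otimes>\<^bsub>Aut V\<^esub> \<psi> \<in> carrier (LAut W V)"
      using A.m_closed[OF \<phi> \<psi>] unfolding LAut_def proj by auto
  qed
qed

lemma group_LAut:
  fixes W :: "('k::field ^ 'n) set"
  shows "vec.subspace W \<Longrightarrow> V \<subseteq> PG W \<Longrightarrow> group (LAut W V)"
proof -
  assume *: "vec.subspace W" "V \<subseteq> PG W"
  then have "group (Aut V)" by (intro group_Aut) (auto simp: PG_def)
  with subgroup.subgroup_is_group[OF subgroup_LAut[OF *]] show ?thesis by (simp add: LAut_def)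
qed

end

theory Submission
  imports Defs "HOL-Algebra.Multiplicative_Group"
begin

text \<open>The points of \<open>V\<close> with pairwise distinct coordinates form a nonempty set closed under swapping two
  coordinates. Comparing a form at a point and at its swapped copy, one can divide by \<open>x\<^sub>i - x\<^sub>j\<close>; so,
  by induction on the degree, the only forms of degree at most three that vanish on \<open>V\<close> are, on the
  hyperplane \<open>\<Sum>x\<^sub>i = 0\<close>, the combinations of \<open>\<Sum>x\<^sub>i\<^sup>2\<close> and \<open>\<Sum>x\<^sub>i\<^sup>3\<close>. Hence a linear map preserving \<open>V\<close> multiplies
  \<open>\<Sum>x\<^sub>i\<^sup>2\<close> by a constant, and changes \<open>\<Sum>x\<^sub>i\<^sup>3\<close> by a constant factor and a multiple of \<open>\<Sum>x\<^sub>i\<^sup>2\<close>.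

  Adjoin a coordinate \<open>x\<^sub>0\<close> of weight \<open>- m\<close> and work modulo translations: the cubic form
  \<open>\<Sum>x\<^sub>i\<^sup>3 - m x\<^sub>0\<^sup>3\<close> on the space \<open>\<Sum>x\<^sub>i = m x\<^sub>0\<close> is then preserved up to a factor by a suitable lift of the map.
  The vectors whose polar bilinear form has rank at most two are the multiples of the differences of
  two weighted unit vectors. As the lift permutes these, it comes from a permutation of the \<open>m + 1\<close> coordinates.
  If \<open>m + 1 \<noteq> 0\<close> in \<open>\<bbbK>\<close>, the value of the cubic form distinguishes the differences that involve \<open>x\<^sub>0\<close>, so \<open>x\<^sub>0\<close> is
  fixed and the projectivity has an order dividing \<open>m!\<close>, which is prime to \<open>p\<close>. If \<open>m + 1 = p\<close>, all weights
  are one and all the permutations in \<open>Sym\<^sub>p\<close> act.\<close>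

section \<open>Forms vanishing on a set closed under swaps\<close>

definition linear_form :: "('k::field ^ 'n \<Rightarrow> 'k) \<Rightarrow> bool" where
  "linear_form L \<longleftrightarrow> (\<forall>x y. L (x + y) = L x + L y) \<and> (\<forall>c x. L (c *s x) = c * L x)"

definition sym_bilinear :: "('k::field ^ 'n \<Rightarrow> 'k ^ 'n \<Rightarrow> 'k) \<Rightarrow> bool" where
  "sym_bilinear B \<longleftrightarrow> (\<forall>x. linear_form (B x)) \<and> (\<forall>x y. B x y = B y x)"

definition sym_trilinear :: "('k::field ^ 'n \<Rightarrow> 'k ^ 'n \<Rightarrow> 'k ^ 'n \<Rightarrow> 'k) \<Rightarrow> bool" where
  "sym_trilinear T \<longleftrightarrow> (\<forall>x. sym_bilinear (T x)) \<and> (\<forall>x y z. T x y z = T y x z)"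

definition dot :: "'k::field ^ 'n \<Rightarrow> 'k ^ 'n \<Rightarrow> 'k" where
  "dot x y = (\<Sum>i\<in>UNIV. x $ i * y $ i)"

definition cub :: "'k::field ^ 'n \<Rightarrow> 'k ^ 'n \<Rightarrow> 'k ^ 'n \<Rightarrow> 'k" where
  "cub x y z = (\<Sum>i\<in>UNIV. x $ i * y $ i * z $ i)"

definition axis_diff :: "'n \<Rightarrow> 'n \<Rightarrow> 'k::field ^ 'n" where
  "axis_diff i j = axis i 1 - axis j 1"

definition sum_zero :: "('k::field ^ 'n) set" where
  "sum_zero = {x. (\<Sum>i\<in>UNIV. x $ i) = 0}"

section \<open>Multilinear forms and differences of unit vectors\<close>

lemma ex_not_in_if_card_less: "card A < CARD('a) \<Longrightarrow> \<exists>x. x \<notin> A" for A :: "'a::finite set"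
  by (metis UNIV_eq_I less_irrefl)

lemma linear_formD:
  assumes "linear_form L"
  shows "L (x + y) = L x + L y" "L (x - y) = L x - L y" "L (c *s x) = c * L x" "L 0 = 0" "L (- x) = - L x"
proof -
  have add: "L (x + y) = L x + L y" and scale: "L (c *s x) = c * L x" for c x y
    using assms by (auto simp: linear_form_def)
  show "L (x + y) = L x + L y" "L (c *s x) = c * L x" by (rule add, rule scale)
  show "L 0 = 0" using scale[of 0 0] by simp
  have neg: "L (- x) = - L x" for x using scale[of "-1" x] by simp
  show "L (- x) = - L x" by (rule neg)
  show "L (x - y) = L x - L y" using add[of x "- y"] neg[of y] by simp
qed

lemma linear_form_sum: "linear_form L \<Longrightarrow> L (\<Sum>i\<in>A. g i) = (\<Sum>i\<in>A. L (g i))"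
  by (induction A rule: infinite_finite_induct) (simp_all add: linear_formD)

lemma sym_bilinearD:
  assumes "sym_bilinear B"
  shows "linear_form (B x)" "linear_form (\<lambda>x. B x y)" "B x y = B y x"
  using assms by (auto simp: sym_bilinear_def linear_form_def)

lemma sym_trilinearD:
  assumes "sym_trilinear T"
  shows "linear_form (T x y)" "linear_form (\<lambda>y. T x y z)" "linear_form (\<lambda>x. T x y z)"
    "T x y z = T y x z" "T x y z = T x z y"
  using assms by (auto simp: sym_trilinear_def sym_bilinear_def linear_form_def)

lemmas bilinear_simps =
  linear_formD[OF sym_bilinearD(1)] linear_formD[OF sym_bilinearD(2)]

lemmas trilinear_simps =
  linear_formD[OF sym_trilinearD(1)] linear_formD[OF sym_trilinearD(2)] linear_formD[OF sym_trilinearD(3)]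

lemma sym_bilinear_dot: "sym_bilinear dot"
  by (auto simp: sym_bilinear_def linear_form_def dot_def algebra_simps sum.distrib sum_distrib_left)

lemma sym_trilinear_cub: "sym_trilinear cub"
  by (auto simp: sym_trilinear_def sym_bilinear_def linear_form_def cub_def algebra_simps
      sum.distrib sum_distrib_left)

lemma axis_diff_nth: "axis_diff i j $ k = (if k = i then 1 else 0) - (if k = j then 1 else 0)"
  by (auto simp: axis_diff_def axis_def)

lemma axis_diff_self [simp]: "axis_diff i i = 0"
  by (simp add: axis_diff_def)

lemma dot_axis_diff: "dot x (axis_diff i j) = x $ i - x $ j"
  by (simp add: dot_def axis_diff_nth right_diff_distrib sum_subtractf if_distrib[where f = "(*) _"]
      cong: if_cong)

lemma axis_diff_sum_zero: "axis_diff i j \<in> sum_zero"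
  by (simp add: sum_zero_def axis_diff_nth sum_subtractf)

lemma axis_diff_diff: "axis_diff i k - axis_diff j k = axis_diff i j"
  by (simp add: axis_diff_def)

lemma sum_zero_expansion:
  assumes "x \<in> sum_zero"
  shows "x = (\<Sum>i\<in>UNIV. x $ i *s axis_diff i j)"
proof (rule vec_eq_iff[THEN iffD2], rule allI)
  fix k
  have "(\<Sum>i\<in>UNIV. x $ i *s axis_diff i j) $ k
      = (\<Sum>i\<in>UNIV. if k = i then x $ i else 0) - (\<Sum>i\<in>UNIV. x $ i) * (if k = j then 1 else 0)"
    by (simp add: axis_diff_nth right_diff_distrib sum_subtractf sum_distrib_right
        if_distrib[where f = "(*) _"] cong: if_cong)
  then show "x $ k = (\<Sum>i\<in>UNIV. x $ i *s axis_diff i j) $ k"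
    using assms by (simp add: sum_zero_def)
qed

lemma linear_form_sum_zero:
  assumes "linear_form L" "\<And>i. L (axis_diff i j) = 0" "x \<in> sum_zero"
  shows "L x = 0"
proof -
  have "L x = (\<Sum>i\<in>UNIV. x $ i * L (axis_diff i j))"
    by (subst sum_zero_expansion[OF assms(3), of j]) (simp add: linear_form_sum linear_formD assms(1))
  then show ?thesis by (simp add: assms(2))
qed

text \<open>The swap of two coordinates is written as the reflection in the root
  \<open>axis_diff i j\<close>, so that multilinear forms can be expanded at the swapped point;
  \<open>distinct\<close> makes it possible to cancel \<open>x $ i - x $ j\<close>
  afterwards.\<close>

locale swap_closed =
  fixes W :: "('k::field ^ 'n) set"
  assumes nonempty: "W \<noteq> {}"
    and swap: "x \<in> W \<Longrightarrow> x - (x $ i - x $ j) *s axis_diff i j \<in> W"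
    and distinct: "x \<in> W \<Longrightarrow> i \<noteq> j \<Longrightarrow> x $ i \<noteq> x $ j"
begin

text \<open>The values of \<open>L\<close> at a point and at its swapped copy are both zero and
  differ by \<open>(x $ i - x $ j) * L (axis_diff i j)\<close>.\<close>

lemma linear_vanishing:
  assumes L: "linear_form L" and W: "\<And>x. x \<in> W \<Longrightarrow> L x = 0"
  shows "L (axis_diff i j) = 0"
proof (cases "i = j")
  case False
  obtain x where x: "x \<in> W" using nonempty by blast
  have "(x $ i - x $ j) * L (axis_diff i j) = L x - L (x - (x $ i - x $ j) *s axis_diff i j)"
    by (simp only: linear_formD[OF L]) simp
  also have "\<dots> = 0" using W[OF x] W[OF swap[OF x, of i j]] by simp
  finally have "(x $ i - x $ j) * L (axis_diff i j) = 0" .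
  then show ?thesis using distinct[OF x False] by (metis mult_eq_0_iff right_minus_eq)
qed (simp add: linear_formD(4)[OF L])

lemma linear_vanishing_sum_zero:
  "linear_form L \<Longrightarrow> (\<And>x. x \<in> W \<Longrightarrow> L x = 0) \<Longrightarrow> x \<in> sum_zero \<Longrightarrow> L x = 0"
  using linear_vanishing linear_form_sum_zero by blast

text \<open>With r the root and d = \<open>dot x r\<close>, the difference of \<open>B\<close> at a
  point and at its swapped copy is d times \<open>2 * B x r - d * B r r\<close>. Cancelling d leaves
  a linear form that vanishes on \<open>W\<close>, hence on \<open>sum_zero\<close>.\<close>

lemma bilinear_vanishing_axis_diff:
  assumes B: "sym_bilinear B" and W: "\<And>x. x \<in> W \<Longrightarrow> B x x = 0" and x: "x \<in> sum_zero"
  shows "2 * B x (axis_diff i j) = dot x (axis_diff i j) * B (axis_diff i j) (axis_diff i j)"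
proof (cases "i = j")
  case False
  let ?r = "axis_diff i j"
  let ?L = "\<lambda>x. 2 * B x ?r - dot x ?r * B ?r ?r"
  have "?L x = 0"
  proof (rule linear_vanishing_sum_zero[OF _ _ x])
    show "linear_form ?L"
      by (auto simp: linear_form_def bilinear_simps[OF B] bilinear_simps[OF sym_bilinear_dot] algebra_simps)
    fix x assume x: "x \<in> W"
    have "(x $ i - x $ j) * ?L x = B x x - B (x - (x $ i - x $ j) *s ?r) (x - (x $ i - x $ j) *s ?r)"
      using sym_bilinearD(3)[OF B, of ?r x]
      by (simp add: dot_axis_diff bilinear_simps[OF B] algebra_simps)
    also have "\<dots> = 0" using W[OF x] W[OF swap[OF x, of i j]] by simp
    finally show "?L x = 0" using distinct[OF x False] by simp
  qed
  then show ?thesis by simp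
qed (simp add: bilinear_simps[OF B])

text \<open>Two roots sharing the index j have \<open>dot\<close> equal to 1. The preceding
  identity, applied to them in both orders, shows by symmetry of \<open>B\<close> that
  \<open>B\<close> takes the same value on all roots; the identity then determines \<open>B\<close>
  on the spanning roots.\<close>

lemma bilinear_vanishing:
  assumes B: "sym_bilinear B" and W: "\<And>x. x \<in> W \<Longrightarrow> B x x = 0"
    and two: "(2::'k) \<noteq> 0"
  obtains b where "\<And>x y. x \<in> sum_zero \<Longrightarrow> y \<in> sum_zero \<Longrightarrow> B x y = b * dot x y"
proof -
  fix j :: 'n
  note eq = bilinear_vanishing_axis_diff[OF B W]
  have same: "B (axis_diff i j) (axis_diff i j) = B (axis_diff k j) (axis_diff k j)"
    if "i \<noteq> j" "k \<noteq> j" for i k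
  proof (cases "i = k")
    case False
    have "2 * B (axis_diff k j) (axis_diff i j) = B (axis_diff i j) (axis_diff i j)"
      "2 * B (axis_diff i j) (axis_diff k j) = B (axis_diff k j) (axis_diff k j)"
      using eq[OF _ axis_diff_sum_zero, of k j i j] eq[OF _ axis_diff_sum_zero, of i j k j] that False
      by (auto simp: dot_axis_diff axis_diff_nth)
    then show ?thesis using sym_bilinearD(3)[OF B, of "axis_diff k j" "axis_diff i j"] by simp
  qed simp
  \<comment> \<open>\<open>dot r r = 2\<close> for a nonzero root r, hence the factor 2. If j is the
    only index, any b will do.\<close>
  obtain b where b: "\<And>i. i \<noteq> j \<Longrightarrow> B (axis_diff i j) (axis_diff i j) = 2 * b"
  proof (cases "\<exists>k. k \<noteq> j")
    case True
    then obtain k where "k \<noteq> j" by blast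
    show ?thesis
      by (rule that[of "B (axis_diff k j) (axis_diff k j) / 2"]) (subst same[OF _ \<open>k \<noteq> j\<close>], use two in simp_all)
  qed (use that in blast)
  have "B x y = b * dot x y" if x: "x \<in> sum_zero" and y: "y \<in> sum_zero" for x y
  proof -
    let ?L = "\<lambda>y. B x y - b * dot x y"
    have "?L y = 0"
    proof (rule linear_form_sum_zero[OF _ _ y])
      show "linear_form ?L"
        by (auto simp: linear_form_def bilinear_simps[OF B] bilinear_simps[OF sym_bilinear_dot] algebra_simps)
      show "?L (axis_diff i j) = 0" for i
      proof (cases "i = j")
        case False
        have "2 * B x (axis_diff i j) = 2 * (b * dot x (axis_diff i j))"
          using eq[OF _ x, of i j] b[OF False] by (simp add: ac_simps)
        then show ?thesis using two by simp
      qed (simp add: bilinear_simps[OF B] bilinear_simps[OF sym_bilinear_dot])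
    qed
    then show ?thesis by simp
  qed
  then show thesis by (rule that)
qed

end

lemma cub_axis_diff: "cub x y (axis_diff i j) = x $ i * y $ i - x $ j * y $ j"
  by (simp add: cub_def axis_diff_nth right_diff_distrib sum_subtractf if_distrib[where f = "(*) _"]
      cong: if_cong)

lemma sum_axis_diff_mult: "(\<Sum>l\<in>UNIV. axis_diff i j $ l * g l) = g i - g j"
  by (simp add: axis_diff_nth left_diff_distrib sum_subtractf if_distrib[where f = "\<lambda>c. c * _"]
      cong: if_cong)

lemma trilinear_diff_cubed:
  assumes T: "sym_trilinear T"
  shows "T (x - y) (x - y) (x - y) = T x x x - 3 * T x x y + 3 * T x y y - T y y y"
  using sym_trilinearD(4,5)[OF T]
  by (simp add: trilinear_simps[OF T] algebra_simps)

section \<open>Cubic forms vanishing on a set closed under swaps\<close>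

context swap_closed
begin

text \<open>Dividing the difference of the cubic values at a point and at its swapped copy by
  \<open>dot x r\<close> leaves a quadratic form that vanishes on \<open>W\<close>. By the quadratic
  case it is a multiple of \<open>dot\<close>, and its value at \<open>r\<close> gives the
  factor.\<close>

lemma trilinear_vanishing_axis_diff:
  fixes i j :: 'n
  assumes T: "sym_trilinear T" and W: "\<And>x. x \<in> W \<Longrightarrow> T x x x = 0" and two: "(2::'k) \<noteq> 0"
    and x: "x \<in> sum_zero" and y: "y \<in> sum_zero"
  defines "r \<equiv> axis_diff i j"
  shows "6 * T x y r = 3 * (dot x r * T y r r + dot y r * T x r r)
    - 2 * dot x r * dot y r * T r r r + T r r r * dot x y"
proof (cases "i = j")
  case False
  \<comment> \<open>This is the polar form of twice that quotient; doubling avoids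
    denominators.\<close>
  let ?B = "\<lambda>x y. 6 * T x y r - 3 * (dot x r * T y r r + dot y r * T x r r)
    + 2 * dot x r * dot y r * T r r r"
  note simps = trilinear_simps[OF T] bilinear_simps[OF sym_bilinear_dot]
  have "sym_bilinear ?B"
    using sym_trilinearD(4)[OF T]
    by (auto simp: sym_bilinear_def linear_form_def simps algebra_simps)
  moreover have "?B x x = 0" if x: "x \<in> W" for x
  proof -
    let ?d = "x $ i - x $ j"
    have "?d * (3 * T x x r - 3 * ?d * T x r r + ?d * ?d * T r r r)
        = T x x x - T (x - ?d *s r) (x - ?d *s r) (x - ?d *s r)"
      unfolding trilinear_diff_cubed[OF T] by (simp add: simps algebra_simps)
    also have "\<dots> = 0" using W[OF x] W[OF swap[OF x, of i j]] by (simp add: r_def)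
    finally have "2 * (3 * T x x r - 3 * ?d * T x r r + ?d * ?d * T r r r) = 0"
      using distinct[OF x False] by simp
    then show ?thesis unfolding r_def dot_axis_diff by (simp add: algebra_simps)
  qed
  ultimately obtain b where b: "\<And>x y. x \<in> sum_zero \<Longrightarrow> y \<in> sum_zero \<Longrightarrow> ?B x y = b * dot x y"
    using bilinear_vanishing[of ?B] two by blast
  have rr: "dot r r = 2" using False by (simp add: r_def dot_axis_diff axis_diff_nth)
  have "?B r r = b * dot r r" by (rule b) (simp_all add: r_def axis_diff_sum_zero)
  then have "2 * T r r r = 2 * b" unfolding rr by (simp add: algebra_simps)
  then have "b = T r r r" using two by simp
  then show ?thesis using b[OF x y] by (simp add: algebra_simps)
qed (simp add: r_def trilinear_simps[OF T] bilinear_simps[OF sym_bilinear_dot])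

text \<open>For two roots r and s ending at the same index, the preceding identity gives
  \<open>T s s r = T s r r\<close>, so the mixed terms in the expansion of the cube of r - s cancel.
  The cubic values on roots are thus differences of a function of one index, which a linear form can
  reproduce.\<close>

lemma trilinear_vanishing_additive:
  assumes T: "sym_trilinear T" and W: "\<And>x. x \<in> W \<Longrightarrow> T x x x = 0"
    and two: "(2::'k) \<noteq> 0" and three: "(3::'k) \<noteq> 0"
  shows "T (axis_diff i j) (axis_diff i j) (axis_diff i j)
    = T (axis_diff i k) (axis_diff i k) (axis_diff i k) - T (axis_diff j k) (axis_diff j k) (axis_diff j k)"
proof -
  note simps = trilinear_simps[OF T]
  have neg: "axis_diff j i = - (axis_diff i j :: 'k ^ 'n)" for i j by (simp add: axis_diff_def)
  consider "i = k" | "j = k" | "i = j" | "i \<noteq> j" "i \<noteq> k" "j \<noteq> k" by blast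
  then show ?thesis
  proof cases
    case 1 then show ?thesis using neg[of j k] by (simp add: simps)
  next
    case 4
    let ?r = "axis_diff i k :: 'k ^ 'n" and ?s = "axis_diff j k :: 'k ^ 'n"
    have "6 * T ?s ?s ?r = 6 * T ?s ?r ?r"
      using trilinear_vanishing_axis_diff[OF T W two, of ?s ?s i k] 4
      by (simp add: axis_diff_sum_zero dot_axis_diff axis_diff_nth)
    then have "T ?s ?s ?r = T ?s ?r ?r" using two three mult_eq_0_iff[of "2::'k" 3] by simp
    then have "T ?r ?s ?s = T ?r ?r ?s" using sym_trilinearD(4,5)[OF T] by metis
    then show ?thesis
      using trilinear_diff_cubed[OF T, of ?r ?s] by (simp add: axis_diff_diff)
  qed (simp_all add: simps)
qed

text \<open>Once the cubes of roots vanish, \<open>T x x r\<close> is determined by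
  \<open>dot x r\<close> and \<open>T x r r\<close>. The latter turns out to be a constant times
  \<open>x $ i + x $ j\<close>, and the product of \<open>x $ i - x $ j\<close> and
  \<open>x $ i + x $ j\<close> is \<open>cub x x r\<close>.\<close>

lemma trilinear_vanishing_traceless:
  assumes T: "sym_trilinear T" and W: "\<And>x. x \<in> W \<Longrightarrow> T x x x = 0"
    and two: "(2::'k) \<noteq> 0" and three: "(3::'k) \<noteq> 0" and card: "CARD('n) \<ge> 3"
    and cubes: "\<And>i j. T (axis_diff i j) (axis_diff i j) (axis_diff i j) = 0"
  obtains \<beta> where "\<And>x. x \<in> sum_zero \<Longrightarrow> T x x x = \<beta> * cub x x x"
proof -
  note simps = trilinear_simps[OF T]
  have eq: "2 * T x y (axis_diff i j) = dot x (axis_diff i j) * T y (axis_diff i j) (axis_diff i j)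
      + dot y (axis_diff i j) * T x (axis_diff i j) (axis_diff i j)"
    if "x \<in> sum_zero" "y \<in> sum_zero" for x y i j
  proof -
    have "3 * (2 * T x y (axis_diff i j)) = 3 * (dot x (axis_diff i j) * T y (axis_diff i j) (axis_diff i j)
      + dot y (axis_diff i j) * T x (axis_diff i j) (axis_diff i j))"
      using trilinear_vanishing_axis_diff[OF T W two that, of i j] by (simp add: cubes)
    then show ?thesis using mult_left_cancel[OF three] by blast
  qed
  have ex: "\<exists>\<beta>. \<forall>x\<in>sum_zero. T x (axis_diff i j) (axis_diff i j) = \<beta> * (x $ i + x $ j)" if "i \<noteq> j" for i j
  proof -
    let ?r = "axis_diff i j :: 'k ^ 'n"
    have "card {i, j} < CARD('n)" using card card_insert_le_m1[of 2 "{j}" i] by simp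
    then obtain k where k: "k \<notin> {i, j}" using ex_not_in_if_card_less by blast
    \<comment> \<open>At \<open>axis_diff j k\<close> the sum of the coordinates i and j is 1, so
      this is the only possible factor.\<close>
    let ?\<beta> = "T (axis_diff j k) ?r ?r"
    let ?L = "\<lambda>x. T x ?r ?r - ?\<beta> * (x $ i + x $ j)"
    have "?L x = 0" if "x \<in> sum_zero" for x
    proof (rule linear_form_sum_zero[where L = ?L, OF _ _ that])
      show "linear_form ?L" by (auto simp: linear_form_def simps algebra_simps)
      fix l
      show "?L (axis_diff l k) = 0"
      proof (cases "l = i \<or> l = j \<or> l = k")
        case True
        have "T (axis_diff i k) ?r ?r = T ?r ?r ?r + T (axis_diff j k) ?r ?r"
          by (simp flip: simps add: axis_diff_def)
        then show ?thesis using True k \<open>i \<noteq> j\<close> by (auto simp: axis_diff_nth cubes simps)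
      next
        case False
        \<comment> \<open>The two roots have no index in common, so both \<open>dot\<close> terms
          vanish.\<close>
        have "2 * T ?r ?r (axis_diff l k) = 0"
          using eq[OF axis_diff_sum_zero axis_diff_sum_zero, of i j i j l k] False k
          by (auto simp: dot_axis_diff axis_diff_nth)
        then have "T (axis_diff l k) ?r ?r = 0"
          using two sym_trilinearD(4,5)[OF T] by (metis mult_eq_0_iff)
        then show ?thesis using False k by (auto simp: axis_diff_nth)
      qed
    qed
    then show ?thesis by auto
  qed
  then obtain \<beta> where \<beta>: "\<And>i j x. i \<noteq> j \<Longrightarrow> x \<in> sum_zero \<Longrightarrow>
      T x (axis_diff i j) (axis_diff i j) = \<beta> i j * (x $ i + x $ j)"
    by metis
  fix o' :: 'n
  \<comment> \<open>Two roots r and s ending at \<open>o'\<close> have \<open>dot\<close> equal to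
    1, which gives \<open>T s s r = T s r r\<close>; each side is one of the two constants.\<close>
  have const: "\<beta> i o' = \<beta> j o'" if "i \<noteq> o'" "j \<noteq> o'" for i j
  proof (cases "i = j")
    case False
    let ?r = "axis_diff i o' :: 'k ^ 'n" and ?s = "axis_diff j o' :: 'k ^ 'n"
    have "2 * T ?s ?s ?r = 2 * T ?s ?r ?r"
      using eq[OF axis_diff_sum_zero axis_diff_sum_zero, of j o' j o' i o'] False that
      by (auto simp: dot_axis_diff axis_diff_nth)
    then have "T ?r ?s ?s = T ?s ?r ?r" using two sym_trilinearD(4,5)[OF T] by (metis mult_left_cancel)
    then show ?thesis
      using \<beta>[OF that(1) axis_diff_sum_zero, of j o'] \<beta>[OF that(2) axis_diff_sum_zero, of i o'] that False
      by (auto simp: axis_diff_nth)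
  qed simp
  obtain b where b: "\<And>i. i \<noteq> o' \<Longrightarrow> \<beta> i o' = b"
    using const by metis
  have "T x x x = b * cub x x x" if x: "x \<in> sum_zero" for x
  proof -
    let ?L = "\<lambda>z. T x x z - b * cub x x z"
    have "?L x = 0"
    proof (rule linear_form_sum_zero[where L = ?L, OF _ _ x])
      show "linear_form ?L"
        by (auto simp: linear_form_def simps trilinear_simps[OF sym_trilinear_cub] algebra_simps)
      fix i
      show "?L (axis_diff i o') = 0"
      proof (cases "i = o'")
        case False
        have "2 * T x x (axis_diff i o') = 2 * (b * cub x x (axis_diff i o'))"
          using eq[OF x x, of i o'] \<beta>[OF False x] b[OF False]
          by (simp add: dot_axis_diff cub_axis_diff algebra_simps)
        then show ?thesis using two by simp
      qed (simp add: simps trilinear_simps[OF sym_trilinear_cub])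
    qed
    then show ?thesis by simp
  qed
  then show thesis by (rule that)
qed

text \<open>The cubic values on roots are removed by subtracting a linear form times
  \<open>dot\<close>. The rest still vanishes on \<open>W\<close>, since \<open>dot\<close> does,
  and the preceding lemma makes it a multiple of \<open>cub\<close>.\<close>

lemma trilinear_vanishing:
  assumes T: "sym_trilinear T" and W: "\<And>x. x \<in> W \<Longrightarrow> T x x x = 0"
    and two: "(2::'k) \<noteq> 0" and three: "(3::'k) \<noteq> 0" and card: "CARD('n) \<ge> 3"
    and dot: "\<And>x. x \<in> W \<Longrightarrow> dot x x = 0"
  obtains \<beta> \<mu> where "linear_form \<mu>" "\<And>x. x \<in> sum_zero \<Longrightarrow> T x x x = \<beta> * cub x x x + \<mu> x * dot x x"
proof -
  fix o' :: 'n
  define t where "t i = T (axis_diff i o') (axis_diff i o') (axis_diff i o')" for i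
  \<comment> \<open>The half compensates \<open>dot r r = 2\<close>: it gives
    \<open>\<mu> r * dot r r = T r r r\<close> on roots.\<close>
  define \<mu> where "\<mu> x = (\<Sum>i\<in>UNIV. x $ i * (t i / 2))" for x :: "'k ^ 'n"
  have \<mu>: "linear_form \<mu>"
    by (auto simp: linear_form_def \<mu>_def algebra_simps sum.distrib sum_distrib_left add_divide_distrib)
  have \<mu>_axis_diff: "\<mu> (axis_diff i j) = (t i - t j) / 2" for i j
    by (simp only: \<mu>_def sum_axis_diff_mult diff_divide_distrib)
  define T' where "T' x y z = T x y z - (\<mu> x * dot y z + \<mu> y * dot x z + \<mu> z * dot x y) / 3" for x y z
  have T': "sym_trilinear T'"
    using sym_trilinearD(4,5)[OF T] sym_bilinearD(3)[OF sym_bilinear_dot]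
    unfolding sym_trilinear_def sym_bilinear_def linear_form_def T'_def
    by (auto simp: trilinear_simps[OF T] linear_formD[OF \<mu>] bilinear_simps[OF sym_bilinear_dot]
        algebra_simps add_divide_distrib diff_divide_distrib)
  have T'_cube: "T' x x x = T x x x - \<mu> x * dot x x" for x
    using three by (simp add: T'_def field_simps)
  have "T' (axis_diff i j) (axis_diff i j) (axis_diff i j) = 0" for i j
  proof (cases "i = j")
    case False
    then show ?thesis
      using two trilinear_vanishing_additive[OF T W two three, of i j o']
      by (simp add: T'_cube \<mu>_axis_diff dot_axis_diff axis_diff_nth t_def)
  qed (simp add: trilinear_simps[OF T'])
  then obtain \<beta> where "\<And>x. x \<in> sum_zero \<Longrightarrow> T' x x x = \<beta> * cub x x x"
    using trilinear_vanishing_traceless[OF T' _ two three card] W dot by (auto simp: T'_cube)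
  then show thesis using \<mu> that[of \<mu> \<beta>] by (simp add: T'_cube algebra_simps)
qed

end

section \<open>The cone over the curve\<close>

text \<open>The affine cone over the curve, with the zero vector included; the exponent 1 puts it
  into the hyperplane.\<close>

definition curve_cone :: "('k::field ^ 'n) set" where
  "curve_cone = {x. \<forall>k\<in>{1..CARD('n) - 2}. (\<Sum>i\<in>UNIV. (x $ i) ^ k) = 0}"

definition distinct_cone :: "('k::field ^ 'n) set" where
  "distinct_cone = {x \<in> curve_cone. inj (($) x)}"

section \<open>Roots of unity and a point of the cone with distinct coordinates\<close>

lemma order_le_1_if_simple_root:
  fixes q :: "'k::field poly"
  assumes "q \<noteq> 0" and "poly q x = 0 \<Longrightarrow> poly (pderiv q) x \<noteq> 0"
  shows "Polynomial.order x q \<le> 1"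
proof (rule ccontr)
  assume "\<not> Polynomial.order x q \<le> 1"
  then have "[:- x, 1:] ^ 2 dvd q" by (metis order_divides not_less_eq_eq numeral_2_eq_2 One_nat_def)
  then obtain r where "q = [:- x, 1:] ^ 2 * r" by (elim dvdE)
  then have "poly q x = 0" "poly (pderiv q) x = 0"
    by (simp_all add: power2_eq_square pderiv_mult pderiv_pCons del: mult_pCons_left)
  then show False using assms(2) by blast
qed

lemma proots_linear_factors: "proots (\<Prod>x\<in>#A. [:- x, 1:]) = A"
proof (induction A)
  case (add x A)
  have "proots ([:- x, 1:] * (\<Prod>x\<in>#A. [:- x, 1:])) = {#x#} + A"
    by (subst proots_mult) (auto simp: prod_mset_zero_iff add simp del: mult_pCons_left)
  then show ?case by simp
qed simp

lemma card_simple_roots: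
  fixes q :: "'k::alg_closed_field poly"
  assumes "q \<noteq> 0" and "\<And>x. poly q x = 0 \<Longrightarrow> poly (pderiv q) x \<noteq> 0"
  shows "card {x. poly q x = 0} = degree q"
proof -
  obtain A where A: "size A = degree q" "q = Polynomial.smult (lead_coeff q) (\<Prod>x\<in>#A. [:- x, 1:])"
    using alg_closed_imp_factorization[OF assms(1)] by blast
  have "proots q = A"
    using assms(1) by (subst A(2)) (simp add: proots_linear_factors)
  moreover have "proots q = mset_set {x. poly q x = 0}"
  proof (rule multiset_eqI)
    fix x
    have "Polynomial.order x q \<noteq> 0 \<longleftrightarrow> poly q x = 0" using order_root[of q x] assms(1) by auto
    with order_le_1_if_simple_root[OF assms, of x]
    have "Polynomial.order x q = (if poly q x = 0 then 1 else 0)" by auto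
    then show "count (proots q) x = count (mset_set {x. poly q x = 0}) x"
      using assms(1) by (simp add: poly_roots_finite count_mset_set')
  qed
  ultimately show ?thesis using A(1) by (metis size_mset_set)
qed

text \<open>Since \<open>N\<close> is invertible, the derivative \<open>N * t ^ (N - 1)\<close> does
  not vanish at a root, so all the roots are simple.\<close>

lemma
  fixes N :: nat
  assumes "(of_nat N :: 'k::alg_closed_field) \<noteq> 0"
  shows finite_roots_of_unity: "finite {t::'k. t ^ N = 1}"
    and card_roots_of_unity: "card {t::'k. t ^ N = 1} = N"
proof -
  have N: "N > 0" using assms by (cases N) auto
  let ?q = "Polynomial.monom 1 N - 1 :: 'k poly"
  have deg: "degree ?q = N"
    using N degree_add_eq_left[of "- 1" "Polynomial.monom 1 N :: 'k poly"] by (simp add: degree_monom_eq)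
  have q: "?q \<noteq> 0" using deg N by force
  have "card {t. poly ?q t = 0} = degree ?q"
  proof (rule card_simple_roots[OF q])
    fix t assume "poly ?q t = 0"
    then have "t ^ N = 1" by (simp add: poly_monom)
    then have "t \<noteq> 0" using N by (auto simp: zero_power)
    then show "poly (pderiv ?q) t \<noteq> 0"
      using assms by (simp add: pderiv_diff pderiv_monom poly_monom)
  qed
  moreover have "{t. poly ?q t = 0} = {t. t ^ N = 1}" by (simp add: poly_monom)
  ultimately show "finite {t::'k. t ^ N = 1}" "card {t::'k. t ^ N = 1} = N"
    using poly_roots_finite[OF q] deg by simp_all
qed

text \<open>Some \<open>N\<close>-th root of unity s has \<open>s ^ k \<noteq> 1\<close>, because at
  most \<open>k\<close> elements violate this. Multiplication by s permutes the roots of unity but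
  multiplies the sum by \<open>s ^ k\<close>.\<close>

lemma sum_roots_of_unity_power:
  assumes "(of_nat N :: 'k::alg_closed_field) \<noteq> 0" and "0 < k" "k < N"
  shows "(\<Sum>t | t ^ N = 1. (t::'k) ^ k) = 0"
proof -
  let ?R = "{t::'k. t ^ N = 1}" and ?q = "Polynomial.monom 1 k - 1 :: 'k poly"
  have deg: "degree ?q = k"
    using assms(2) degree_add_eq_left[of "- 1" "Polynomial.monom 1 k :: 'k poly"] by (simp add: degree_monom_eq)
  then have q: "?q \<noteq> 0" using assms(2) by force
  have "card {t. poly ?q t = 0} \<le> k" using card_poly_roots_bound[OF q] deg by simp
  then have "\<not> ?R \<subseteq> {t. poly ?q t = 0}"
    using card_mono[OF poly_roots_finite[OF q], of ?R] card_roots_of_unity[OF assms(1)] assms(3) by force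
  then obtain s where "s \<in> ?R" "poly ?q s \<noteq> 0" by blast
  then have s: "s ^ N = 1" "s ^ k \<noteq> 1" by (auto simp: poly_monom)
  then have "s \<noteq> 0" using assms(3) by (auto simp: zero_power)
  have bij: "bij_betw ((*) s) ?R ?R"
  proof (rule bij_betw_byWitness[where f' = "(*) (inverse s)"])
  qed (use s \<open>s \<noteq> 0\<close> in \<open>auto simp: power_mult_distrib power_inverse simp flip: mult.assoc\<close>)
  have "s ^ k * (\<Sum>t\<in>?R. t ^ k) = (\<Sum>t\<in>?R. t ^ k)"
    using sum.reindex_bij_betw[OF bij, of "\<lambda>t. t ^ k"]
    by (simp add: power_mult_distrib sum_distrib_left)
  then show ?thesis using s(2) by (metis mult_cancel_right1)
qed

text \<open>The witness has as its coordinates 0 and all the roots of unity of order dividing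
  \<open>CARD('n) - 1\<close>.\<close>

lemma distinct_cone_nonempty:
  assumes "(of_nat (CARD('n) - 1) :: 'k::alg_closed_field) \<noteq> 0"
  shows "(distinct_cone :: ('k ^ 'n) set) \<noteq> {}"
proof -
  let ?N = "CARD('n) - 1"
  let ?R = "{t::'k. t ^ ?N = 1}"
  have N: "?N > 0" using assms by (rule contrapos_np) simp
  then have "card (insert 0 ?R) = CARD('n)"
    using finite_roots_of_unity[OF assms] card_roots_of_unity[OF assms] by (simp add: zero_power)
  then obtain g :: "'n \<Rightarrow> 'k" where g: "bij_betw g UNIV (insert 0 ?R)"
    using finite_same_card_bij[of "UNIV :: 'n set" "insert 0 ?R"] finite_roots_of_unity[OF assms] by auto
  have "(\<Sum>i\<in>UNIV. g i ^ k) = 0" if "k \<in> {1..CARD('n) - 2}" for k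
  proof -
    have "0 < k" "k < ?N" using that N by auto
    then show ?thesis
      using sum.reindex_bij_betw[OF g, of "\<lambda>t. t ^ k"] sum_roots_of_unity_power[OF assms, of k]
        finite_roots_of_unity[OF assms] by (simp add: zero_power)
  qed
  then have "(\<chi> i. g i) \<in> distinct_cone"
    using bij_betw_imp_inj_on[OF g] by (simp add: distinct_cone_def curve_cone_def vec_lambda_inverse)
  then show ?thesis by blast
qed

lemma swap_eq: "x - (x $ i - x $ j) *s axis_diff i j = (\<chi> k. x $ Transposition.transpose i j k)"
  by (auto simp: vec_eq_iff axis_diff_nth Transposition.transpose_def)

lemma swap_closed_distinct_cone:
  assumes "(of_nat (CARD('n) - 1) :: 'k::alg_closed_field) \<noteq> 0"
  shows "swap_closed (distinct_cone :: ('k ^ 'n) set)"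
proof
  show "(distinct_cone :: ('k ^ 'n) set) \<noteq> {}" by (rule distinct_cone_nonempty[OF assms])
  fix x :: "'k ^ 'n" and i j
  assume x: "x \<in> distinct_cone"
  have "(\<Sum>l\<in>UNIV. x $ Transposition.transpose i j l ^ k) = (\<Sum>l\<in>UNIV. x $ l ^ k)" for k
    by (rule sum.reindex_bij_betw) simp
  moreover have "inj (\<lambda>l. x $ Transposition.transpose i j l)"
    using x inj_compose[of "($) x" "Transposition.transpose i j"] by (simp add: distinct_cone_def o_def)
  ultimately show "x - (x $ i - x $ j) *s axis_diff i j \<in> distinct_cone"
    using x unfolding swap_eq by (simp add: distinct_cone_def curve_cone_def vec_lambda_inverse)
  show "i \<noteq> j \<Longrightarrow> x $ i \<noteq> x $ j" using x by (auto simp: distinct_cone_def inj_def)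
qed

lemma curve_cone_sum_zero: "3 \<le> CARD('n) \<Longrightarrow> x \<in> curve_cone \<Longrightarrow> x \<in> sum_zero" for x :: "'k::field ^ 'n"
  unfolding curve_cone_def sum_zero_def by (auto dest!: bspec[of _ _ 1])

lemma curve_cone_dot: "4 \<le> CARD('n) \<Longrightarrow> x \<in> curve_cone \<Longrightarrow> dot x x = 0" for x :: "'k::field ^ 'n"
  unfolding curve_cone_def dot_def by (auto simp: power2_eq_square dest!: bspec[of _ _ 2])

lemma curve_cone_cub: "5 \<le> CARD('n) \<Longrightarrow> x \<in> curve_cone \<Longrightarrow> cub x x x = 0" for x :: "'k::field ^ 'n"
  unfolding curve_cone_def cub_def by (auto simp: power3_eq_cube dest!: bspec[of _ _ 3])

section \<open>The effect of a map preserving the cone on \<open>dot\<close> and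
  \<open>cub\<close>\<close>

lemma sym_bilinear_compose:
  assumes f: "Vector_Spaces.linear (*s) (*s) f" and B: "sym_bilinear B"
  shows "sym_bilinear (\<lambda>x y. B (f x) (f y))"
  using sym_bilinearD[OF B]
  by (simp add: sym_bilinear_def linear_form_def vec.linear_add[OF f] vec.linear_scale[OF f])

lemma sym_trilinear_compose:
  assumes f: "Vector_Spaces.linear (*s) (*s) f" and T: "sym_trilinear T"
  shows "sym_trilinear (\<lambda>x y z. T (f x) (f y) (f z))"
  using sym_bilinear_compose[OF f, of "T (f _)"] T by (auto simp: sym_trilinear_def)

text \<open>The pullbacks of \<open>dot\<close> and \<open>cub\<close> along \<open>f\<close> vanish
  on \<open>distinct_cone\<close>, so the classification of such forms applies to them. Surjectivity
  of \<open>f\<close> excludes zero factors.\<close>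

lemma dot_cub_preserved:
  fixes f :: "'k::alg_closed_field ^ 'n \<Rightarrow> 'k ^ 'n"
  assumes f: "Vector_Spaces.linear (*s) (*s) f" and cone: "f ` curve_cone \<subseteq> curve_cone"
    and f_bij: "bij_betw f sum_zero sum_zero"
    and card: "CARD('n) \<ge> 5" and char: "(of_nat (CARD('n) - 1) :: 'k) \<noteq> 0"
    and two: "(2::'k) \<noteq> 0" and three: "(3::'k) \<noteq> 0"
  obtains b \<beta> \<mu> where "linear_form \<mu>" "b \<noteq> 0" "\<beta> \<noteq> 0"
    "\<And>x. x \<in> sum_zero \<Longrightarrow> dot (f x) (f x) = b * dot x x"
    "\<And>x. x \<in> sum_zero \<Longrightarrow> cub (f x) (f x) (f x) = \<beta> * cub x x x + \<mu> x * dot x x"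
proof -
  interpret swap_closed "distinct_cone :: ('k ^ 'n) set"
    by (rule swap_closed_distinct_cone[OF char])
  have W: "x \<in> curve_cone" "f x \<in> curve_cone" if "x \<in> distinct_cone" for x
    using that cone by (auto simp: distinct_cone_def)
  have dot0: "dot x x = 0" "dot (f x) (f x) = 0" and cub0: "cub (f x) (f x) (f x) = 0" if "x \<in> distinct_cone" for x
    using W[OF that] card by (simp_all add: curve_cone_dot curve_cone_cub)
  obtain b where b: "\<And>x y. x \<in> sum_zero \<Longrightarrow> y \<in> sum_zero \<Longrightarrow> dot (f x) (f y) = b * dot x y"
    by (rule bilinear_vanishing[OF sym_bilinear_compose[OF f sym_bilinear_dot] dot0(2) two, rotated])
      (rule that, assumption)
  have card3: "CARD('n) \<ge> 3" using card by simp
  obtain \<beta> \<mu> where \<mu>: "linear_form \<mu>"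
    and \<beta>: "\<And>x. x \<in> sum_zero \<Longrightarrow> cub (f x) (f x) (f x) = \<beta> * cub x x x + \<mu> x * dot x x"
    by (rule trilinear_vanishing[OF sym_trilinear_compose[OF f sym_trilinear_cub] cub0 two three card3 dot0(1), rotated 2])
      (rule that, assumption)
  have surj: "\<exists>y\<in>sum_zero. f y = x" if "x \<in> sum_zero" for x
    using that f_bij by (metis bij_betw_def image_iff)
  fix i :: 'n
  have card_lt: "card {i} < CARD('n)" "card {i, j} < CARD('n)" for j
    using card by (simp_all add: card_insert_if)
  obtain j where "j \<notin> {i}" using ex_not_in_if_card_less[OF card_lt(1)] by blast
  moreover obtain k where "k \<notin> {i, j}" using ex_not_in_if_card_less[OF card_lt(2)] by blast
  ultimately have neq: "i \<noteq> j" "i \<noteq> k" "j \<noteq> k" "j \<noteq> i" "k \<noteq> i" "k \<noteq> j" by auto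
  have "b \<noteq> 0"
  proof
    assume "b = 0"
    obtain y where "y \<in> sum_zero" "f y = axis_diff i j" using surj[OF axis_diff_sum_zero] by blast
    then show False using b[of y y] \<open>b = 0\<close> neq two by (simp add: dot_axis_diff axis_diff_nth)
  qed
  moreover have "\<beta> \<noteq> 0"
  proof
    assume "\<beta> = 0"
    \<comment> \<open>A root has \<open>cub\<close> zero but \<open>dot\<close> nonzero. So
      \<open>\<mu>\<close> vanishes at the preimages of roots, hence also at that of a sum of two
      roots, where \<open>cub\<close> is 1 + 1 - 8 = -6.\<close>
    have \<mu>0: "\<mu> y = 0" if "y \<in> sum_zero" "f y = axis_diff i j" "i \<noteq> j" for y i j
      using that b[of y y] \<beta>[of y] two \<open>\<beta> = 0\<close>
      by (auto simp: dot_axis_diff cub_axis_diff axis_diff_nth)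
    obtain u v where uv: "u \<in> sum_zero" "f u = axis_diff i k" "v \<in> sum_zero" "f v = axis_diff j k"
      using surj[OF axis_diff_sum_zero] by metis
    let ?z = "axis_diff i k + axis_diff j k :: 'k ^ 'n"
    have "f (u + v) = ?z" using uv by (simp add: vec.linear_add[OF f])
    moreover have "u + v \<in> sum_zero" using uv by (simp add: sum_zero_def sum.distrib)
    moreover have "\<mu> (u + v) = 0" using \<mu>0[OF uv(1,2)] \<mu>0[OF uv(3,4)] neq by (simp add: linear_formD[OF \<mu>])
    ultimately have "cub ?z ?z ?z = 0" using \<beta>[of "u + v"] \<open>\<beta> = 0\<close> by simp
    moreover have "cub ?z ?z ?z = - (2 * 3)"
      using neq by (simp add: trilinear_simps[OF sym_trilinear_cub] cub_axis_diff axis_diff_nth)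
    ultimately have "(2::'k) * 3 = 0" by simp
    then show False using two three unfolding mult_eq_0_iff by blast
  qed
  ultimately show thesis using that[OF \<mu>] b \<beta> by simp
qed

section \<open>Lifting to the weighted space with an additional coordinate\<close>

text \<open>The weights add up to zero, so that adding a constant to all coordinates preserves
  \<open>balanced\<close>.\<close>

definition weight :: "'n::finite option \<Rightarrow> 'k::field" where
  "weight a = (case a of None \<Rightarrow> - of_nat CARD('n) | Some i \<Rightarrow> 1)"

definition balanced :: "('k::field ^ 'n::finite option) set" where
  "balanced = {y. (\<Sum>a\<in>UNIV. weight a * y $ a) = 0}"

definition wcub :: "'k::field ^ 'n::finite option \<Rightarrow> 'k ^ 'n option \<Rightarrow> 'k ^ 'n option \<Rightarrow> 'k" where
  "wcub y z w = (\<Sum>a\<in>UNIV. weight a * (y $ a * z $ a * w $ a))"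

text \<open>Dividing by the weights makes the weighted pairing with this vector the difference of
  the coordinates at \<open>a\<close> and \<open>b\<close>.\<close>

definition wroot :: "'n::finite option \<Rightarrow> 'n option \<Rightarrow> 'k::field ^ 'n::finite option" where
  "wroot a b = axis a (inverse (weight a)) - axis b (inverse (weight b))"

text \<open>The quotient map by the constant vectors; \<open>translate x t\<close> is the
  representative of \<open>x\<close> with value \<open>t\<close> at \<open>None\<close>.\<close>

definition drop_origin :: "'k::field ^ 'n::finite option \<Rightarrow> 'k ^ 'n" where
  "drop_origin y = (\<chi> i. y $ Some i - y $ None)"

definition translate :: "'k::field ^ 'n \<Rightarrow> 'k \<Rightarrow> 'k ^ 'n option" where
  "translate x t = (\<chi> a. case a of None \<Rightarrow> t | Some i \<Rightarrow> x $ i + t)"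

lemma sum_UNIV_option: "(\<Sum>a\<in>UNIV. g a) = g None + (\<Sum>i\<in>UNIV. g (Some i))" for g :: "'n::finite option \<Rightarrow> _"
  by (simp add: UNIV_option_conv sum.reindex)

lemma weight_simps [simp]: "weight (None :: 'n::finite option) = - of_nat CARD('n)" "weight (Some i) = 1"
  by (simp_all add: weight_def)

lemma translate_nth [simp]: "translate x t $ None = t" "translate x t $ Some i = x $ i + t"
  by (simp_all add: translate_def)

lemma drop_origin_nth [simp]: "drop_origin y $ i = y $ Some i - y $ None"
  by (simp add: drop_origin_def)

lemma drop_origin_translate [simp]: "drop_origin (translate x t) = x"
  by (simp add: vec_eq_iff)

lemma translate_drop_origin: "translate (drop_origin y) (y $ None) = y"
  by (auto simp: vec_eq_iff translate_def split: option.split)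

lemma translate_balanced [simp]: "translate x t \<in> balanced \<longleftrightarrow> x \<in> sum_zero"
  by (simp add: balanced_def sum_zero_def sum_UNIV_option sum.distrib)

lemma drop_origin_sum_zero: "y \<in> balanced \<Longrightarrow> drop_origin y \<in> sum_zero"
  by (metis translate_balanced translate_drop_origin)

text \<open>The weight of \<open>None\<close> removes the cubic term in \<open>t\<close>, and
  \<open>x \<in> sum_zero\<close> the quadratic one. What remains shows that shifting
  \<open>t\<close> by a linear form in \<open>x\<close> adds a multiple of \<open>dot\<close>, which
  is what the lift needs to absorb \<open>\<mu>\<close>.\<close>

lemma wcub_translate:
  assumes "x \<in> sum_zero"
  shows "wcub (translate x t) (translate x t) (translate x t) = cub x x x + 3 * t * dot x x"
proof -
  have "wcub (translate x t) (translate x t) (translate x t)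
      = (\<Sum>i\<in>UNIV. (x $ i + t) * (x $ i + t) * (x $ i + t) - t * t * t)"
    by (simp add: wcub_def sum_UNIV_option sum_subtractf)
  also have "\<dots> = (\<Sum>i\<in>UNIV. x $ i * x $ i * x $ i + 3 * t * (x $ i * x $ i) + 3 * t * t * x $ i)"
    by (rule sum.cong) (simp_all add: algebra_simps)
  also have "\<dots> = cub x x x + 3 * t * dot x x"
    using assms by (simp add: cub_def dot_def sum.distrib sum_zero_def flip: sum_distrib_left)
  finally show ?thesis .
qed

lemma sym_trilinearI:
  assumes "\<And>x y. linear_form (T x y)" "\<And>x y z. T x y z = T y x z" "\<And>x y z. T x y z = T x z y"
  shows "sym_trilinear T"
  using assms by (simp add: sym_trilinear_def sym_bilinear_def)

lemma sym_trilinear_wcub: "sym_trilinear wcub"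
  by (auto simp: sym_trilinear_def sym_bilinear_def linear_form_def wcub_def algebra_simps
      sum.distrib sum_distrib_left)

lemma sym_trilinear_polarization:
  assumes T: "sym_trilinear T" and S: "\<And>y. y \<in> S \<Longrightarrow> T y y y = 0"
    and add: "\<And>y z. y \<in> S \<Longrightarrow> z \<in> S \<Longrightarrow> y + z \<in> S"
    and two: "(2::'k::field) \<noteq> 0" and three: "(3::'k) \<noteq> 0"
    and "y \<in> S" "z \<in> S" "w \<in> S"
  shows "(T y z w :: 'k) = 0"
proof -
  have "2 * 3 * T y z w = T (y + z + w) (y + z + w) (y + z + w) - T (y + z) (y + z) (y + z)
      - T (y + w) (y + w) (y + w) - T (z + w) (z + w) (z + w) + T y y y + T z z z + T w w w"
    using sym_trilinearD(4,5)[OF T] by (simp add: trilinear_simps[OF T] algebra_simps)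
  also have "\<dots> = 0" using S add assms(6-8) by simp
  finally show ?thesis using two three by (simp only: mult_eq_0_iff) simp
qed

lemma balanced_add: "y \<in> balanced \<Longrightarrow> z \<in> balanced \<Longrightarrow> y + z \<in> balanced"
  by (simp add: balanced_def algebra_simps sum.distrib)

lemma balanced_scale: "y \<in> balanced \<Longrightarrow> c *s y \<in> balanced"
  by (simp add: balanced_def algebra_simps flip: sum_distrib_left)

lemma balanced_lift:
  fixes f h :: "'k::alg_closed_field ^ 'n \<Rightarrow> 'k ^ 'n"
  assumes f: "Vector_Spaces.linear (*s) (*s) f" and h: "Vector_Spaces.linear (*s) (*s) h"
    and cone: "h ` curve_cone \<subseteq> curve_cone"
    and f_into: "\<And>x. x \<in> sum_zero \<Longrightarrow> f x \<in> sum_zero" and h_bij: "bij_betw h sum_zero sum_zero"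
    and hf: "\<And>x. x \<in> sum_zero \<Longrightarrow> h (f x) = x"
    and card: "CARD('n) \<ge> 5" and char: "(of_nat (CARD('n) - 1) :: 'k) \<noteq> 0"
    and two: "(2::'k) \<noteq> 0" and three: "(3::'k) \<noteq> 0"
  obtains F G :: "'k ^ 'n option \<Rightarrow> 'k ^ 'n option" and \<beta>
  where "\<And>a. linear_form (\<lambda>y. F y $ a)" "\<And>a. linear_form (\<lambda>y. G y $ a)"
    "F ` balanced \<subseteq> balanced" "G ` balanced \<subseteq> balanced"
    "\<And>y. y \<in> balanced \<Longrightarrow> G (F y) = y" "\<And>y. drop_origin (F y) = f (drop_origin y)"
    "\<beta> \<noteq> 0" "\<And>y z w. y \<in> balanced \<Longrightarrow> z \<in> balanced \<Longrightarrow> w \<in> balanced \<Longrightarrow>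
      wcub (G y) (G z) (G w) = \<beta> * wcub y z w"
proof -
  obtain b \<beta> \<mu> where \<mu>: "linear_form \<mu>" and b: "b \<noteq> 0" and \<beta>: "\<beta> \<noteq> 0"
    and dot_h: "\<And>x. x \<in> sum_zero \<Longrightarrow> dot (h x) (h x) = b * dot x x"
    and cub_h: "\<And>x. x \<in> sum_zero \<Longrightarrow> cub (h x) (h x) (h x) = \<beta> * cub x x x + \<mu> x * dot x x"
    by (rule dot_cub_preserved[OF h cone h_bij card char two three]) (rule that)
  \<comment> \<open>With this choice the term \<open>3 * \<nu> x * (b * dot x x)\<close> cancels
    \<open>\<mu> x * dot x x\<close>, and the scaling \<open>\<beta> / b\<close> of the new
    coordinate gives both remaining terms the factor \<open>\<beta>\<close>. \<open>F\<close> solves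
    for the coordinate so as to invert \<open>G\<close>.\<close>
  define \<nu> where "\<nu> x = - \<mu> x / (3 * b)" for x
  define G where "G y = translate (h (drop_origin y)) (\<nu> (drop_origin y) + \<beta> / b * y $ None)" for y
  define F where "F y = translate (f (drop_origin y)) ((y $ None - \<nu> (f (drop_origin y))) / (\<beta> / b))" for y
  have drop: "drop_origin (y + z) = drop_origin y + drop_origin z" "drop_origin (c *s y) = c *s drop_origin y"
    for y z :: "'k ^ 'n option" and c
    by (simp_all add: vec_eq_iff algebra_simps)
  note lin = drop vec.linear_add[OF f] vec.linear_scale[OF f] vec.linear_add[OF h] vec.linear_scale[OF h]
    linear_formD[OF \<mu>]
  show thesis
  proof (rule that[of F G \<beta>])
    show "linear_form (\<lambda>y. F y $ a)" "linear_form (\<lambda>y. G y $ a)" for a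
      by (cases a; simp add: linear_form_def F_def G_def \<nu>_def lin algebra_simps add_divide_distrib diff_divide_distrib)+
    show "F ` balanced \<subseteq> balanced"
      by (auto simp: F_def intro!: f_into drop_origin_sum_zero)
    show G: "G ` balanced \<subseteq> balanced"
      using bij_betwE[OF h_bij] by (auto simp: G_def intro: drop_origin_sum_zero)
    show "G (F y) = y" if "y \<in> balanced" for y
      using b \<beta> drop_origin_sum_zero[OF that] by (simp add: F_def G_def hf translate_drop_origin)
    show "drop_origin (F y) = f (drop_origin y)" for y by (simp add: F_def)
    show "\<beta> \<noteq> 0" by (rule \<beta>)
    let ?T = "\<lambda>y z w. wcub (G y) (G z) (G w) - \<beta> * wcub y z w"
    have G_lin: "G (y + z) = G y + G z" "G (c *s y) = c *s G y" for y z c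
      unfolding G_def vec_eq_iff
      by (auto simp: translate_def lin \<nu>_def algebra_simps add_divide_distrib diff_divide_distrib split: option.split)
    have "sym_trilinear ?T"
    proof (rule sym_trilinearI)
      show "linear_form (?T x y)" for x y
        by (auto simp: linear_form_def G_lin trilinear_simps[OF sym_trilinear_wcub] algebra_simps)
      show "?T x y z = ?T y x z" for x y z
        using sym_trilinearD(4)[OF sym_trilinear_wcub, of x y z]
          sym_trilinearD(4)[OF sym_trilinear_wcub, of "G x" "G y" "G z"] by simp
      show "?T x y z = ?T x z y" for x y z
        using sym_trilinearD(5)[OF sym_trilinear_wcub, of x y z]
          sym_trilinearD(5)[OF sym_trilinear_wcub, of "G x" "G y" "G z"] by simp
    qed
    moreover have "?T y y y = 0" if "y \<in> balanced" for y
    proof -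
      let ?x = "drop_origin y" and ?t = "y $ None"
      have x: "?x \<in> sum_zero" "h ?x \<in> sum_zero"
        using drop_origin_sum_zero[OF that] h_bij by (auto simp: bij_betw_def)
      have "wcub (G y) (G y) (G y) = cub (h ?x) (h ?x) (h ?x) + 3 * (\<nu> ?x + \<beta> / b * ?t) * dot (h ?x) (h ?x)"
        unfolding G_def by (rule wcub_translate[OF x(2)])
      also have "\<dots> = \<beta> * (cub ?x ?x ?x + 3 * ?t * dot ?x ?x)"
        unfolding dot_h[OF x(1)] cub_h[OF x(1)] \<nu>_def using b three by (simp add: field_simps)
      also have "\<dots> = \<beta> * wcub y y y"
        using wcub_translate[OF x(1), of ?t] by (simp add: translate_drop_origin)
      finally show ?thesis by simp
    qed
    ultimately have "?T y z w = 0" if "y \<in> balanced" "z \<in> balanced" "w \<in> balanced" for y z w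
      by (rule sym_trilinear_polarization[where T = ?T, OF _ _ balanced_add two three that])
    then show "wcub (G y) (G z) (G w) = \<beta> * wcub y z w"
      if "y \<in> balanced" "z \<in> balanced" "w \<in> balanced" for y z w
      using that by simp
  qed
qed

text \<open>The cross product of the coefficient vectors is a solution; if it is zero, the vectors
  are proportional and one nonzero equation suffices.\<close>

lemma two_homogeneous_equations:
  fixes a1 a2 a3 b1 b2 b3 :: "'k::field"
  obtains c1 c2 c3 where "(c1, c2, c3) \<noteq> (0, 0, 0)"
    "c1 * a1 + c2 * a2 + c3 * a3 = 0" "c1 * b1 + c2 * b2 + c3 * b3 = 0"
proof (cases "a2 * b3 = a3 * b2 \<and> a3 * b1 = a1 * b3 \<and> a1 * b2 = a2 * b1")
  case False
  show ?thesis
    by (rule that[of "a2 * b3 - a3 * b2" "a3 * b1 - a1 * b3" "a1 * b2 - a2 * b1"])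
       (use False in \<open>auto simp: algebra_simps\<close>)
next
  case True
  consider "a1 \<noteq> 0 \<or> a2 \<noteq> 0" | "b1 \<noteq> 0 \<or> b2 \<noteq> 0" | "a1 = 0" "b1 = 0" by blast
  then show ?thesis
  proof cases
    case 1
    show ?thesis by (rule that[of a2 "- a1" 0]) (use 1 True in \<open>auto simp: algebra_simps\<close>)
  next
    case 2
    show ?thesis by (rule that[of b2 "- b1" 0]) (use 2 True in \<open>auto simp: algebra_simps\<close>)
  next
    case 3
    show ?thesis by (rule that[of 1 0 0]) (use 3 in auto)
  qed
qed

section \<open>Vectors of rank at most two for \<open>wcub\<close>, and their supports\<close>

context
  assumes card_nz: "(of_nat CARD('n::finite) :: 'k::field) \<noteq> 0"
begin

lemma weight_nz: "(weight (a :: 'n option) :: 'k) \<noteq> 0"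
  using card_nz by (cases a) auto

lemma wroot_nth: "(wroot a b :: 'k ^ 'n option) $ d
    = (if d = a then inverse (weight d) else 0) - (if d = b then inverse (weight d) else 0)"
  by (auto simp: wroot_def axis_def)

lemma sum_weight_wroot: "(\<Sum>d\<in>UNIV. weight d * ((wroot a b :: 'k ^ 'n option) $ d * g d)) = g a - g b"
proof -
  have "weight d * ((wroot a b :: 'k ^ 'n option) $ d * g d) = (if d = a then g d else 0) - (if d = b then g d else 0)" for d
    using weight_nz by (auto simp: wroot_nth)
  then show ?thesis by (simp add: sum_subtractf)
qed

lemma wroot_balanced: "(wroot a b :: 'k ^ 'n option) \<in> balanced"
  using sum_weight_wroot[of a b "\<lambda>_. 1"] by (simp add: balanced_def)

lemma wcub_wroot: "wcub y z (wroot a b :: 'k ^ 'n option) = y $ a * z $ a - y $ b * z $ b"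
  using sum_weight_wroot[of a b "\<lambda>d. y $ d * z $ d"] by (simp add: wcub_def ac_simps)

text \<open>The hypothesis \<open>ker\<close> bounds by two the rank of the bilinear form obtained
  from \<open>y\<close>. If \<open>y\<close> had three nonzero coordinates, a nonzero combination z
  of three roots at these indices would lie in both kernels, although pairing with \<open>y\<close>
  and z detects it.\<close>

lemma support_card_le_2:
  fixes y :: "'k ^ 'n option"
  assumes L: "linear_form L" and M: "linear_form M"
    and ker: "\<And>z w. z \<in> balanced \<Longrightarrow> w \<in> balanced \<Longrightarrow> L z = 0 \<Longrightarrow> M z = 0 \<Longrightarrow> wcub y z w = 0"
    and card: "CARD('n) \<ge> 4"
  shows "card {a. y $ a \<noteq> 0} \<le> 2"
proof (rule ccontr)
  assume "\<not> card {a. y $ a \<noteq> 0} \<le> 2"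
  then obtain S where "S \<subseteq> {a. y $ a \<noteq> 0}" "card S = 3"
    using obtain_subset_with_card_n[of 3 "{a. y $ a \<noteq> 0}"] by auto
  then obtain i j k where ijk: "y $ i \<noteq> 0" "y $ j \<noteq> 0" "y $ k \<noteq> 0" "i \<noteq> j" "i \<noteq> k" "j \<noteq> k"
    by (auto simp: card_3_iff)
  have "CARD('n option) \<ge> 5" using card by (simp add: card_UNIV_option)
  then have card_lt: "card {i, j, k} < CARD('n option)" "card {i, j, k, l} < CARD('n option)" for l
    by (simp_all add: card_insert_if)
  obtain l where l1: "l \<notin> {i, j, k}" using ex_not_in_if_card_less[OF card_lt(1)] by blast
  \<comment> \<open>Here z vanishes. Testing against the root from a to \<open>l'\<close> therefore
    gives \<open>y $ a * ?z $ a = 0\<close>.\<close>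
  obtain l' where l2: "l' \<notin> {i, j, k, l}" using ex_not_in_if_card_less[OF card_lt(2)] by blast
  note l = l1 l2
  obtain c1 c2 c3 where c: "(c1, c2, c3) \<noteq> (0, 0, 0)"
    "c1 * L (wroot i l) + c2 * L (wroot j l) + c3 * L (wroot k l) = 0"
    "c1 * M (wroot i l) + c2 * M (wroot j l) + c3 * M (wroot k l) = 0"
    by (rule two_homogeneous_equations)
  let ?z = "c1 *s wroot i l + c2 *s wroot j l + c3 *s wroot k l"
  have z: "?z \<in> balanced" "L ?z = 0" "M ?z = 0"
    using c(2,3) by (simp_all add: balanced_add balanced_scale wroot_balanced linear_formD[OF L] linear_formD[OF M])
  have "y $ a * ?z $ a = 0" if "a \<in> {i, j, k}" for a
    using ker[OF z(1) wroot_balanced z(2,3), of a l'] l by (auto simp: wcub_wroot wroot_nth)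
  then have "?z $ i = 0" "?z $ j = 0" "?z $ k = 0" using ijk by auto
  then show False using c(1) ijk l weight_nz by (auto simp: wroot_nth)
qed

lemma balanced_support_two:
  fixes y :: "'k ^ 'n option"
  assumes "y \<in> balanced" "{d. y $ d \<noteq> 0} = {a, b}" "a \<noteq> b"
  shows "weight b * y $ b = - (weight a * y $ a)" and "y = (weight a * y $ a) *s wroot a b"
proof -
  have 0: "y $ d = 0" if "d \<noteq> a" "d \<noteq> b" for d using assms(2) that by blast
  have "(\<Sum>d\<in>UNIV. weight d * y $ d) = (\<Sum>d\<in>{a, b}. weight d * y $ d)"
    by (rule sum.mono_neutral_right) (use 0 in auto)
  then show *: "weight b * y $ b = - (weight a * y $ a)"
    using assms(1,3) by (simp add: balanced_def add_eq_0_iff)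
  show "y = (weight a * y $ a) *s wroot a b"
    unfolding vec_eq_iff using 0 assms(3) weight_nz *
    by (auto simp: wroot_nth field_simps)
qed

lemma balanced_support_card_2:
  fixes y :: "'k ^ 'n option"
  assumes "y \<in> balanced" "y \<noteq> 0" "card {d. y $ d \<noteq> 0} \<le> 2"
  shows "card {d. y $ d \<noteq> 0} = 2"
proof -
  let ?S = "{d. y $ d \<noteq> 0}"
  have "card ?S \<noteq> 0" using assms(2) by (auto simp: vec_eq_iff)
  moreover have "card ?S \<noteq> 1"
  proof
    assume "card ?S = 1"
    then obtain a where a: "?S = {a}" by (rule card_1_singletonE)
    have "(\<Sum>d\<in>UNIV. weight d * y $ d) = (\<Sum>d\<in>{a}. weight d * y $ d)"
      by (rule sum.mono_neutral_right) (use a in auto)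
    then show False using assms(1) a weight_nz[of a] by (auto simp: balanced_def)
  qed
  ultimately show ?thesis using assms(3) by linarith
qed

text \<open>The supports are edges of a graph. Since the differences also have small support, two
  edges meet in exactly one vertex and the vectors agree there. Pairwise meeting edges form a star
  or a triangle, and signs exclude the triangle. The centre becomes the image of
  \<open>None\<close>.\<close>

lemma star_of_roots:
  fixes u :: "'n \<Rightarrow> 'k ^ 'n option"
  assumes u: "\<And>i. u i \<in> balanced" and supp: "\<And>i. card {d. u i $ d \<noteq> 0} \<le> 2"
    and supp_diff: "\<And>i j. i \<noteq> j \<Longrightarrow> card {d. (u i - u j) $ d \<noteq> 0} \<le> 2"
    and indep: "\<And>i j c d. i \<noteq> j \<Longrightarrow> c *s u i = d *s u j \<Longrightarrow> c = 0"
    and card: "CARD('n) \<ge> 2" and two: "(2::'k) \<noteq> 0"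
  obtains c \<sigma> where "c \<noteq> 0" "bij \<sigma>" "\<And>i. u i = c *s wroot (\<sigma> (Some i)) (\<sigma> None)"
proof -
  define S where "S i = {d. u i $ d \<noteq> 0}" for i
  have ex_other: "\<exists>j. j \<noteq> i" for i :: 'n
    using ex_not_in_if_card_less[of "{i}"] card by auto
  have nz: "u i \<noteq> 0" for i
  proof
    assume "u i = 0"
    obtain j where "j \<noteq> i" using ex_other by blast
    with \<open>u i = 0\<close> indep[of i j 1 0] show False by simp
  qed
  have cardS: "card (S i) = 2" for i
    unfolding S_def by (rule balanced_support_card_2[OF u nz supp])
  have S_pair: "S i = {a, b}" if "a \<in> S i" "b \<in> S i" "a \<noteq> b" for i a b
    using card_subset_eq[of "S i" "{a, b}"] that cardS[of i] by auto
  have S_neq: "S i \<noteq> S j" if "i \<noteq> j" for i j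
  proof
    assume eq: "S i = S j"
    obtain a b where ab: "S i = {a, b}" "a \<noteq> b" using cardS[of i] by (auto simp: card_2_iff)
    then have "u i = (weight a * u i $ a) *s wroot a b" "u j = (weight a * u j $ a) *s wroot a b"
      using balanced_support_two(2)[OF u _ ab(2)] eq by (simp_all add: S_def)
    then have "(weight a * u j $ a) *s u i = (weight a * u i $ a) *s u j"
      by (metis vector_smult_assoc mult.commute)
    then have "weight a * u j $ a = 0" by (rule indep[OF that])
    then show False using weight_nz[of a] ab eq by (auto simp: S_def)
  qed
  have meet: "\<exists>v. S i \<inter> S j = {v} \<and> u i $ v = u j $ v" if "i \<noteq> j" for i j
  proof -
    let ?D = "{d. (u i - u j) $ d \<noteq> 0}"
    have sub: "(S i - S j) \<union> (S j - S i) \<subseteq> ?D" by (auto simp: S_def)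
    have "card (S i \<inter> S j) \<noteq> 2"
      using S_neq[OF that] cardS card_subset_eq[of "S i" "S i \<inter> S j"] card_subset_eq[of "S j" "S i \<inter> S j"] by auto
    moreover have "card (S i \<inter> S j) \<le> 2" using card_mono[of "S i" "S i \<inter> S j"] cardS by simp
    moreover have c: "card ((S i - S j) \<union> (S j - S i)) = (2 - card (S i \<inter> S j)) + (2 - card (S i \<inter> S j))"
      using cardS[of i] cardS[of j]
      by (subst card_Un_disjoint) (auto simp: card_Diff_subset_Int Int_commute)
    moreover have "\<dots> \<le> 2" using card_mono[OF _ sub] supp_diff[OF that] c by simp
    ultimately have 1: "card (S i \<inter> S j) = 1" by linarith
    then obtain v where v: "S i \<inter> S j = {v}" by (rule card_1_singletonE)
    have "(S i - S j) \<union> (S j - S i) = ?D"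
      by (rule card_subset_eq[OF _ sub]) (use c 1 supp_diff[OF that] card_mono[OF _ sub] in simp_all)
    then have "v \<notin> ?D" using v by blast
    then show ?thesis using v by auto
  qed
  fix i0 :: 'n
  obtain j0 where j0: "j0 \<noteq> i0" using ex_other by blast
  obtain v where v: "S i0 \<inter> S j0 = {v}" "u i0 $ v = u j0 $ v" using meet[OF j0[symmetric]] by blast
  \<comment> \<open>Otherwise three supports form a triangle. The weighted coordinate changes sign
    along each edge, so going round once gives a nonzero value equal to its negative.\<close>
  have common: "u k $ v = u i0 $ v" for k
  proof (rule ccontr)
    assume neq: "u k $ v \<noteq> u i0 $ v"
    then have k: "k \<noteq> i0" "k \<noteq> j0" using v(2) by auto
    obtain v1 where v1: "S k \<inter> S i0 = {v1}" "u k $ v1 = u i0 $ v1" using meet[OF k(1)] by blast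
    obtain v2 where v2: "S k \<inter> S j0 = {v2}" "u k $ v2 = u j0 $ v2" using meet[OF k(2)] by blast
    have "v1 \<noteq> v" "v2 \<noteq> v" using v1 v2 v(2) neq by auto
    then have S: "S i0 = {v, v1}" "S j0 = {v, v2}"
      using v(1) v1(1) v2(1) by (intro S_pair; blast)+
    then have "v1 \<noteq> v2" using S_neq[OF j0] by auto
    then have Sk: "S k = {v1, v2}" using v1(1) v2(1) by (intro S_pair; blast)
    have "weight v1 * u i0 $ v1 = - (weight v * u i0 $ v)" "weight v2 * u j0 $ v2 = - (weight v * u i0 $ v)"
      using balanced_support_two(1)[OF u S(1)[unfolded S_def]] balanced_support_two(1)[OF u S(2)[unfolded S_def]]
        \<open>v1 \<noteq> v\<close> \<open>v2 \<noteq> v\<close> v(2) by auto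
    moreover have "weight v2 * u k $ v2 = - (weight v1 * u k $ v1)"
      using balanced_support_two(1)[OF u Sk[unfolded S_def] \<open>v1 \<noteq> v2\<close>] .
    ultimately have "2 * (weight v * u i0 $ v) = 0" using v1(2) v2(2) by simp
    then show False using two weight_nz[of v] v(1) by (auto simp: S_def)
  qed
  \<comment> \<open>The sign is negative because the centre \<open>v\<close> is the second index of
    \<open>wroot\<close>.\<close>
  define c where "c = - (weight v * u i0 $ v)"
  have "u i0 $ v \<noteq> 0" using v(1) by (auto simp: S_def)
  then have c: "c \<noteq> 0" using weight_nz[of v] by (simp add: c_def)
  have "\<exists>t. t \<noteq> v \<and> S i = {v, t}" for i
  proof -
    have "v \<in> S i" using common[of i] \<open>u i0 $ v \<noteq> 0\<close> by (simp add: S_def)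
    then show ?thesis using cardS[of i] by (auto simp: card_2_iff)
  qed
  then obtain \<tau> where \<tau>: "\<And>i. \<tau> i \<noteq> v" "\<And>i. S i = {v, \<tau> i}" by metis
  have u_eq: "u i = c *s wroot (\<tau> i) v" for i
  proof -
    have S: "{d. u i $ d \<noteq> 0} = {\<tau> i, v}" using \<tau>(2)[of i] by (auto simp: S_def)
    show ?thesis
      using balanced_support_two[OF u S \<tau>(1)] common[of i] by (simp add: c_def)
  qed
  define \<sigma> where "\<sigma> a = (case a of None \<Rightarrow> v | Some i \<Rightarrow> \<tau> i)" for a
  have "inj \<sigma>"
  proof (rule injI)
    fix a b assume "\<sigma> a = \<sigma> b"
    then show "a = b"
      using \<tau> S_neq by (auto simp: \<sigma>_def split: option.splits) metis+
  qed
  then have "bij \<sigma>" by (simp add: bij_def finite_UNIV_inj_surj)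
  then show thesis by (rule that[OF c]) (simp add: \<sigma>_def u_eq)
qed

end

section \<open>Linear maps preserving the curve\<close>

text \<open>A vector stands for its class modulo constants, with extra coordinate 0; after the
  permutation the class is normalised again.\<close>

definition perm_map :: "('n::finite option \<Rightarrow> 'n option) \<Rightarrow> 'k::field ^ 'n \<Rightarrow> 'k ^ 'n" where
  "perm_map \<sigma> x = drop_origin (\<chi> a. translate x 0 $ inv' \<sigma> a)"

lemma perm_map_nth: "perm_map \<sigma> x $ j = translate x 0 $ inv' \<sigma> (Some j) - translate x 0 $ inv' \<sigma> None"
  by (simp add: perm_map_def)

lemma sum_wroot_bij:
  fixes x :: "'k::field ^ 'n" and \<sigma> :: "'n option \<Rightarrow> 'n option"
  assumes nz: "(of_nat CARD('n) :: 'k) \<noteq> 0" and x: "x \<in> sum_zero" and \<sigma>: "bij \<sigma>"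
  shows "(\<Sum>i\<in>UNIV. x $ i *s wroot (\<sigma> (Some i)) (\<sigma> None)) $ \<sigma> a = inverse (weight (\<sigma> a)) * translate x 0 $ a"
proof (cases a)
  case None
  have "wroot (\<sigma> (Some i)) (\<sigma> None) $ \<sigma> None = (- inverse (weight (\<sigma> None)) :: 'k)" for i
    using bij_is_inj[OF \<sigma>] by (simp add: wroot_nth[OF nz] inj_eq)
  then have "(\<Sum>i\<in>UNIV. x $ i *s wroot (\<sigma> (Some i)) (\<sigma> None)) $ \<sigma> None
      = (\<Sum>i\<in>UNIV. x $ i) * (- inverse (weight (\<sigma> None)))"
    by (simp add: sum_distrib_right sum_negf)
  then show ?thesis using x None by (simp add: sum_zero_def)
next
  case (Some j)
  then show ?thesis
    using bij_is_inj[OF \<sigma>]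
    by (simp add: wroot_nth[OF nz] inj_eq if_distrib[where f = "(*) _"] cong: if_cong)
qed

lemma translate_sum_wroot:
  fixes x :: "'k::field ^ 'n"
  assumes nz: "(of_nat CARD('n) :: 'k) \<noteq> 0" and x: "x \<in> sum_zero"
  shows "(\<Sum>i\<in>UNIV. x $ i *s wroot (Some i) None) = translate x 0"
proof (rule vec_eq_iff[THEN iffD2], rule allI)
  show "(\<Sum>i\<in>UNIV. x $ i *s wroot (Some i) None) $ a = translate x 0 $ a" for a
    using sum_wroot_bij[OF nz x bij_id, of a] by (cases a) (simp_all del: sum_component)
qed

text \<open>The lift \<open>F\<close> preserves the rank of the bilinear form attached to a vector,
  so it sends roots to vectors with at most two nonzero coordinates. The roots ending at
  \<open>None\<close> then form a star whose shape gives \<open>\<sigma>\<close>.\<close>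

lemma cone_map_is_permutation:
  fixes f h :: "'k::alg_closed_field ^ 'n \<Rightarrow> 'k ^ 'n"
  assumes f: "Vector_Spaces.linear (*s) (*s) f" and h: "Vector_Spaces.linear (*s) (*s) h"
    and cone: "h ` curve_cone \<subseteq> curve_cone"
    and f_into: "\<And>x. x \<in> sum_zero \<Longrightarrow> f x \<in> sum_zero" and h_bij: "bij_betw h sum_zero sum_zero"
    and hf: "\<And>x. x \<in> sum_zero \<Longrightarrow> h (f x) = x"
    and card: "CARD('n) \<ge> 5" and char: "(of_nat (CARD('n) - 1) :: 'k) \<noteq> 0"
    and nz: "(of_nat CARD('n) :: 'k) \<noteq> 0"
    and two: "(2::'k) \<noteq> 0" and three: "(3::'k) \<noteq> 0"
  obtains c \<sigma> where "c \<noteq> 0" "bij \<sigma>" "\<sigma> None = None \<or> (of_nat (CARD('n) + 1) :: 'k) = 0"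
    "\<And>x. x \<in> sum_zero \<Longrightarrow> f x = c *s perm_map \<sigma> x"
proof -
  obtain F G :: "'k ^ 'n option \<Rightarrow> 'k ^ 'n option" and \<beta>
    where F: "\<And>a. linear_form (\<lambda>y. F y $ a)" and G: "\<And>a. linear_form (\<lambda>y. G y $ a)"
      and F_in: "F ` balanced \<subseteq> balanced" and G_in: "G ` balanced \<subseteq> balanced"
      and GF: "\<And>y. y \<in> balanced \<Longrightarrow> G (F y) = y" and drop_F: "\<And>y. drop_origin (F y) = f (drop_origin y)"
      and \<beta>: "\<beta> \<noteq> 0" and wcub_G: "\<And>y z w. y \<in> balanced \<Longrightarrow> z \<in> balanced \<Longrightarrow> w \<in> balanced \<Longrightarrow>
        wcub (G y) (G z) (G w) = \<beta> * wcub y z w"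
    by (rule balanced_lift[OF f h cone _ h_bij _ card char two three], erule f_into, erule hf, rule that)
  have F_simps: "F (y + z) = F y + F z" "F (y - z) = F y - F z" "F (r *s y) = r *s F y" "F 0 = 0" for y z r
    using linear_formD[OF F] by (simp_all add: vec_eq_iff)
  have F_sum: "F (\<Sum>i\<in>A. g i) = (\<Sum>i\<in>A. F (g i))" for A :: "'n set" and g
    by (induction A rule: infinite_finite_induct) (simp_all add: F_simps)
  have F_bal: "F y \<in> balanced" "G y \<in> balanced" if "y \<in> balanced" for y
    using that F_in G_in by blast+
  have supp: "card {d. F (wroot a b) $ d \<noteq> 0} \<le> 2" for a b
  proof (rule support_card_le_2[OF nz G G])
    show "wcub (F (wroot a b)) z w = 0"
      if "z \<in> balanced" "w \<in> balanced" "G z $ a = 0" "G z $ b = 0" for z w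
    proof -
      have "\<beta> * wcub (F (wroot a b)) z w = wcub (wroot a b) (G z) (G w)"
        using wcub_G[OF F_bal(1)[OF wroot_balanced[OF nz]] that(1,2)] GF[OF wroot_balanced[OF nz]] by simp
      also have "\<dots> = wcub (G z) (G w) (wroot a b)"
        using sym_trilinearD(4,5)[OF sym_trilinear_wcub] by metis
      also have "\<dots> = 0" using that by (simp add: wcub_wroot[OF nz])
      finally show ?thesis using \<beta> by simp
    qed
  qed (use card in simp)
  let ?u = "\<lambda>i. F (wroot (Some i) None)"
  have card2: "CARD('n) \<ge> 2" using card by simp
  obtain c \<sigma> where c: "c \<noteq> 0" and \<sigma>: "bij \<sigma>" and u: "\<And>i. ?u i = c *s wroot (\<sigma> (Some i)) (\<sigma> None)"
  proof (rule star_of_roots[OF nz, of ?u])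
    show "?u i \<in> balanced" for i by (rule F_bal(1)[OF wroot_balanced[OF nz]])
    show "card {d. ?u i $ d \<noteq> 0} \<le> 2" for i by (rule supp)
    show "card {d. (?u i - ?u j) $ d \<noteq> 0} \<le> 2" for i j
    proof -
      have "?u i - ?u j = F (wroot (Some i) (Some j))"
        unfolding F_simps(2)[symmetric] by (simp add: wroot_def)
      then show ?thesis using supp[of "Some i" "Some j"] by simp
    qed
    show "r = 0" if "i \<noteq> j" "r *s ?u i = s *s ?u j" for i j r s
    proof -
      have "G (F (r *s wroot (Some i) None)) = G (F (s *s wroot (Some j) None))"
        using that(2) by (simp add: F_simps)
      then have "r *s wroot (Some i) None = (s *s wroot (Some j) None :: 'k ^ 'n option)"
        by (simp add: GF balanced_scale wroot_balanced[OF nz])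
      from arg_cong[OF this, of "\<lambda>y. y $ Some i"] show ?thesis
        using that(1) by (simp add: wroot_nth[OF nz])
    qed
    show "CARD('n) \<ge> 2" "(2::'k) \<noteq> 0" by (rule card2, rule two)
  qed (rule that)
  \<comment> \<open>If \<open>\<sigma>\<close> moves \<open>None\<close>, some root ending at
    \<open>None\<close> goes to a multiple of a root between two indices of weight 1, where
    \<open>wcub\<close> is zero. Its own value is 1 - 1/m^2 with m = \<open>CARD('n)\<close>, so (m
    - 1)(m + 1) = 0.\<close>
  have dichotomy: "\<sigma> None = None \<or> (of_nat (CARD('n) + 1) :: 'k) = 0"
  proof (cases "\<sigma> None")
    case (Some v)
    fix j :: 'n
    obtain i where "i \<noteq> j" using ex_not_in_if_card_less[of "{j}"] card by auto
    then have "\<sigma> (Some i) \<noteq> \<sigma> (Some j)" using bij_is_inj[OF \<sigma>] by (simp add: inj_eq)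
    then have "\<exists>i. \<sigma> (Some i) \<noteq> None" by metis
    then obtain i w where w: "\<sigma> (Some i) = Some w" by blast
    let ?y = "wroot (Some i) None :: 'k ^ 'n option"
    have "\<beta> * wcub (F ?y) (F ?y) (F ?y) = wcub ?y ?y ?y"
      using wcub_G[OF F_bal(1) F_bal(1) F_bal(1)] by (simp add: GF wroot_balanced[OF nz])
    moreover have "wcub (F ?y) (F ?y) (F ?y) = 0"
      unfolding u w Some trilinear_simps[OF sym_trilinear_wcub]
      using Some w bij_is_inj[OF \<sigma>] by (auto simp: wcub_wroot[OF nz] wroot_nth[OF nz])
    ultimately have "wcub ?y ?y ?y = 0" by simp
    then have "1 - inverse (of_nat CARD('n) :: 'k) * inverse (of_nat CARD('n)) = 0"
      by (simp add: wcub_wroot[OF nz] wroot_nth[OF nz])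
    then have "(of_nat CARD('n) :: 'k) * of_nat CARD('n) = 1" using nz by (simp add: field_simps)
    then have "((of_nat CARD('n) :: 'k) - 1) * (of_nat CARD('n) + 1) = 0" by (simp add: algebra_simps)
    moreover have "(of_nat CARD('n) :: 'k) - 1 \<noteq> 0" using char card by (simp add: of_nat_diff)
    ultimately show ?thesis by (simp add: ac_simps)
  qed simp
  have "f x = c *s perm_map \<sigma> x" if x: "x \<in> sum_zero" for x
  proof -
    let ?z = "\<Sum>i\<in>UNIV. x $ i *s wroot (\<sigma> (Some i)) (\<sigma> None) :: 'k ^ 'n option"
    have "F (translate x 0) = (\<Sum>i\<in>UNIV. x $ i *s (c *s wroot (\<sigma> (Some i)) (\<sigma> None)))"
      unfolding translate_sum_wroot[OF nz x, symmetric] F_sum F_simps(3) u ..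
    also have "\<dots> = c *s ?z" by (simp add: vec_eq_iff sum_distrib_left ac_simps)
    finally have "f x = drop_origin (c *s ?z)" using drop_F[of "translate x 0"] by simp
    also have "\<dots> = c *s drop_origin ?z" by (simp add: vec_eq_iff algebra_simps del: sum_component)
    also have "drop_origin ?z = perm_map \<sigma> x"
    proof -
      have z: "?z $ a = inverse (weight a) * translate x 0 $ inv' \<sigma> a" for a
        using sum_wroot_bij[OF nz x \<sigma>, of "inv' \<sigma> a"] \<sigma> by (simp add: bij_is_surj surj_f_inv_f)
      \<comment> \<open>Only \<open>None\<close> can have a weight other than 1. Either it is fixed,
        with coordinate 0, or its weight is 1 because \<open>CARD('n) + 1\<close> vanishes in the
        field.\<close>
      have "weight a = (1 :: 'k) \<or> translate x 0 $ inv' \<sigma> a = 0" for a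
      proof (cases a)
        case None
        from dichotomy show ?thesis
        proof
          assume "\<sigma> None = None"
          then have "inv' \<sigma> None = None" using inv_f_eq[OF bij_is_inj[OF \<sigma>]] by blast
          then show ?thesis by (simp add: None)
        next
          assume "(of_nat (CARD('n) + 1) :: 'k) = 0"
          then show ?thesis by (simp add: None add_eq_0_iff)
        qed
      qed simp
      then have "?z $ a = translate x 0 $ inv' \<sigma> a" for a unfolding z by (metis inverse_1 mult_1 mult_zero_right)
      then show ?thesis by (simp add: perm_map_def drop_origin_def del: sum_component)
    qed
    finally show ?thesis .
  qed
  then show thesis by (rule that[OF c \<sigma> dichotomy])
qed

section \<open>The action of permutations of all coordinates\<close>

text \<open>Every point of \<open>W\<close> is proportional to its image, by \<open>W\<close>.
  Comparing this relation with that at the swapped point leaves a linear form in x vanishing on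
  \<open>W\<close>; its value at \<open>axis_diff k i\<close> is the claimed coordinate.\<close>

lemma (in swap_closed) eigenvector_on_axis_diff:
  fixes g :: "'k ^ 'n \<Rightarrow> 'k ^ 'n"
  assumes g: "\<And>l. linear_form (\<lambda>x. g x $ l)"
    and W: "\<And>x k l. x \<in> W \<Longrightarrow> x $ k * g x $ l = x $ l * g x $ k"
    and ij: "i \<noteq> j" and l: "l \<notin> {i, j}" and k: "k \<notin> {i, j, l}"
  shows "g (axis_diff i j) $ l = 0"
proof -
  let ?r = "axis_diff i j :: 'k ^ 'n"
  let ?L = "\<lambda>x. x $ k * g ?r $ l - x $ l * g ?r $ k"
  have r: "?r $ k = 0" "?r $ l = 0" using k l by (auto simp: axis_diff_nth)
  have "?L (axis_diff k i) = 0"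
  proof (rule linear_vanishing[where L = ?L])
    show "linear_form ?L" by (auto simp: linear_form_def algebra_simps)
    fix x assume x: "x \<in> W"
    let ?d = "x $ i - x $ j"
    have "(x - ?d *s ?r) $ k * g (x - ?d *s ?r) $ l = (x - ?d *s ?r) $ l * g (x - ?d *s ?r) $ k"
      by (rule W[OF swap[OF x]])
    then have "x $ k * (g x $ l - ?d * g ?r $ l) = x $ l * (g x $ k - ?d * g ?r $ k)"
      unfolding linear_formD[OF g] by (simp add: r)
    then have "?d * ?L x = 0" using W[OF x, of k l] by (simp add: algebra_simps)
    then show "?L x = 0" using distinct[OF x ij] by simp
  qed
  then show ?thesis using k l by (auto simp: axis_diff_nth)
qed

lemma linear_form_perm_map: "linear_form (\<lambda>x. perm_map \<sigma> x $ j)"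
proof -
  have lin: "linear_form (\<lambda>x. translate x 0 $ a)" for a
    by (cases a) (auto simp: linear_form_def)
  show ?thesis
    by (simp add: perm_map_nth linear_form_def linear_formD(1,3)[OF lin] algebra_simps)
qed

lemma linear_perm_map: "Vector_Spaces.linear (*s) (*s) (perm_map \<sigma>)"
  unfolding Vector_Spaces.linear_iff using linear_formD[OF linear_form_perm_map]
  by (auto simp: vec_eq_iff intro: vec.vector_space_axioms)

lemma perm_map_id: "perm_map id x = x"
  by (simp add: vec_eq_iff perm_map_nth)

text \<open>The constant subtracted after the first permutation cancels in the second
  normalisation.\<close>

lemma perm_map_compose:
  assumes "bij \<sigma>" "bij \<tau>"
  shows "perm_map \<sigma> (perm_map \<tau> x) = perm_map (\<sigma> \<circ> \<tau>) x"
proof -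
  have "translate (perm_map \<tau> x) 0 $ a = translate x 0 $ inv' \<tau> a - translate x 0 $ inv' \<tau> None" for a
    by (cases a) (simp_all add: perm_map_nth)
  then show ?thesis using assms by (simp add: vec_eq_iff perm_map_nth o_inv_distrib)
qed

lemma perm_map_inv:
  assumes "bij \<sigma>"
  shows "perm_map \<sigma> (perm_map (inv' \<sigma>) x) = x" "perm_map (inv' \<sigma>) (perm_map \<sigma> x) = x"
  using assms by (simp_all add: perm_map_compose bij_imp_bij_inv perm_map_id surj_iff[THEN iffD1] inj_iff[THEN iffD1]
      bij_is_surj bij_is_inj)

lemma power_sum_translate:
  fixes y :: "'a::finite \<Rightarrow> 'k::field"
  assumes "\<And>l. l \<le> k \<Longrightarrow> (\<Sum>a\<in>UNIV. y a ^ l) = 0"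
  shows "(\<Sum>a\<in>UNIV. (y a + t) ^ k) = 0"
proof -
  have "(\<Sum>a\<in>UNIV. (y a + t) ^ k) = (\<Sum>l\<le>k. of_nat (k choose l) * t ^ (k - l) * (\<Sum>a\<in>UNIV. y a ^ l))"
    unfolding binomial_ring sum_distrib_left by (subst sum.swap) (simp add: ac_simps)
  then show ?thesis using assms by simp
qed

lemma power_sum_translate_option:
  "k > 0 \<Longrightarrow> (\<Sum>a\<in>UNIV. translate x 0 $ a ^ k) = (\<Sum>i\<in>UNIV. x $ i ^ k)"
  by (simp add: sum_UNIV_option zero_power)

text \<open>Adjoining the point \<open>0\<close> to the coordinates of \<open>x\<close> gives a multiset of size \<open>p\<close>, whose power sums
  vanish up to degree \<open>k\<close>, including the zeroth one; this condition is invariant under translations.\<close>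

lemma power_sum_perm_map:
  fixes x :: "'k::field ^ 'n"
  assumes \<sigma>: "bij \<sigma>" and p: "(of_nat (CARD('n) + 1) :: 'k) = 0" and k: "k > 0"
    and x: "\<And>l. 0 < l \<Longrightarrow> l \<le> k \<Longrightarrow> (\<Sum>i\<in>UNIV. x $ i ^ l) = 0"
  shows "(\<Sum>i\<in>UNIV. perm_map \<sigma> x $ i ^ k) = 0"
proof -
  let ?X = "\<lambda>a. translate x 0 $ a"
  have "(\<Sum>i\<in>UNIV. perm_map \<sigma> x $ i ^ k) = (\<Sum>a\<in>UNIV. (?X (inv' \<sigma> a) + (- ?X (inv' \<sigma> None))) ^ k)"
    using k by (simp add: sum_UNIV_option perm_map_nth zero_power)
  also have "\<dots> = (\<Sum>a\<in>UNIV. (?X a + (- ?X (inv' \<sigma> None))) ^ k)"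
    by (rule sum.reindex_bij_betw) (rule bij_imp_bij_inv[OF \<sigma>])
  also have "\<dots> = 0"
  proof (rule power_sum_translate)
    fix l assume "l \<le> k"
    show "(\<Sum>a\<in>UNIV. ?X a ^ l) = 0"
    proof (cases "l = 0")
      case True
      then show ?thesis using p by (simp add: card_UNIV_option)
    next
      case False
      then show ?thesis using x \<open>l \<le> k\<close> by (simp add: power_sum_translate_option)
    qed
  qed
  finally show ?thesis .
qed

lemma perm_map_curve_cone:
  fixes x :: "'k::field ^ 'n"
  assumes "bij \<sigma>" "(of_nat (CARD('n) + 1) :: 'k) = 0" "x \<in> curve_cone"
  shows "perm_map \<sigma> x \<in> curve_cone"
  using assms(3) by (auto simp: curve_cone_def intro!: power_sum_perm_map[OF assms(1,2)])

lemma perm_map_sum_zero: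
  fixes x :: "'k::field ^ 'n"
  assumes "bij \<sigma>" "(of_nat (CARD('n) + 1) :: 'k) = 0" "x \<in> sum_zero"
  shows "perm_map \<sigma> x \<in> sum_zero"
  using power_sum_perm_map[OF assms(1,2), of 1 x] assms(3) by (simp add: sum_zero_def le_Suc_eq)

text \<open>The image of each root is zero outside its two indices, by the preceding lemma on
  proportional points. Following the supports of all roots shows that no index moves.\<close>

lemma perm_map_projectively_trivial:
  fixes \<rho> :: "'n::finite option \<Rightarrow> 'n option"
  assumes \<rho>: "bij \<rho>" and card: "CARD('n) \<ge> 5" and char: "(of_nat (CARD('n) - 1) :: 'k::alg_closed_field) \<noteq> 0"
    and triv: "\<And>x :: 'k ^ 'n. x \<in> distinct_cone \<Longrightarrow> \<exists>c. perm_map \<rho> x = c *s x"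
  shows "\<rho> = id"
proof -
  interpret swap_closed "distinct_cone :: ('k ^ 'n) set"
    by (rule swap_closed_distinct_cone[OF char])
  let ?X = "\<lambda>i j a. translate (axis_diff i j :: 'k ^ 'n) 0 $ a"
  let ?v = "inv' \<rho>"
  have inj: "inj ?v" using \<rho> by (simp add: bij_imp_bij_inv bij_is_inj)
  have cards: "card {i} < CARD('n)" "card {i, j} < CARD('n)" "card {i, j, k} < CARD('n)" for i j k :: 'n
    using card by (simp_all add: card_insert_if)
  have X_supp: "a \<in> {Some i, Some j}" if "?X i j a \<noteq> 0" for i j a
    using that by (cases a) (auto simp: axis_diff_nth split: if_splits)
  have X_nz: "?X i j (Some i) \<noteq> 0" "?X i j (Some j) \<noteq> 0" if "i \<noteq> j" for i j
    using that by (auto simp: axis_diff_nth)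
  have eq: "?X i j (?v (Some l)) = ?X i j (?v None)" if ij: "i \<noteq> j" and l: "l \<notin> {i, j}" for i j l
  proof -
    obtain k where k: "k \<notin> {i, j, l}" using ex_not_in_if_card_less cards(3) by blast
    have "perm_map \<rho> (axis_diff i j :: 'k ^ 'n) $ l = 0"
    proof (rule eigenvector_on_axis_diff[OF linear_form_perm_map _ ij l k])
      fix x :: "'k ^ 'n" and k l assume "x \<in> distinct_cone"
      then show "x $ k * perm_map \<rho> x $ l = x $ l * perm_map \<rho> x $ k"
        using triv by fastforce
    qed
    then show ?thesis by (simp add: perm_map_nth)
  qed
  \<comment> \<open>A nonzero value would be shared by the preimages of \<open>None\<close> and of
    two further indices, three distinct places in a support of size two.\<close>
  have zero: "?X i j (?v None) = 0" if ij: "i \<noteq> j" for i j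
  proof (rule ccontr)
    assume nz: "?X i j (?v None) \<noteq> 0"
    obtain l where l: "l \<notin> {i, j}" using ex_not_in_if_card_less cards(2) by blast
    obtain l' where l': "l' \<notin> {i, j, l}" using ex_not_in_if_card_less cards(3) by blast
    have l'_ij: "l' \<notin> {i, j}" using l' by blast
    have "?v None \<in> {Some i, Some j}" "?v (Some l) \<in> {Some i, Some j}" "?v (Some l') \<in> {Some i, Some j}"
      by (rule X_supp, simp only: nz eq[OF ij l] eq[OF ij l'_ij] not_False_eq_True)+
    moreover have "?v None \<noteq> ?v (Some l)" "?v None \<noteq> ?v (Some l')" "?v (Some l) \<noteq> ?v (Some l')"
      using inj l' by (auto simp: inj_eq)
    ultimately show False by auto
  qed
  have "?v None \<noteq> Some i" for i
  proof -
    obtain j where "j \<noteq> i" using ex_not_in_if_card_less[of "{i}"] cards(1) by auto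
    then show ?thesis using zero[of i j] X_nz[of i j] by auto
  qed
  then have None: "?v None = None" by (metis option.exhaust)
  have "?v (Some l) = Some l" for l
  proof -
    have "?v (Some l) \<noteq> Some i" if "i \<noteq> l" for i
    proof -
      obtain j where j: "j \<notin> {i, l}" using ex_not_in_if_card_less cards(2) by blast
      then show ?thesis using eq[of i j l] zero[of i j] X_nz[of i j] that by auto
    qed
    moreover have "?v (Some l) \<noteq> None" using None inj by (metis inj_eq option.distinct(1))
    ultimately show ?thesis by (metis option.exhaust)
  qed
  with None have "?v a = a" for a by (cases a) auto
  then have "\<rho> a = a" for a using \<rho> by (metis bij_inv_eq_iff)
  then show ?thesis by auto
qed

text \<open>By pigeonhole the orbit of \<open>a\<close> returns after at most \<open>card A\<close>
  steps, and that number divides the factorial.\<close>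

lemma funpow_fact_fixes:
  assumes \<sigma>: "bij \<sigma>" and A: "finite A" "\<And>a. a \<in> A \<Longrightarrow> \<sigma> a \<in> A" and a: "a \<in> A"
  shows "(\<sigma> ^^ fact (card A)) a = a"
proof -
  have "(\<sigma> ^^ k) a \<in> A" for k by (induction k) (use a A(2) in auto)
  then have "(\<lambda>k. (\<sigma> ^^ k) a) ` {0..card A} \<subseteq> A" by blast
  then have "card ((\<lambda>k. (\<sigma> ^^ k) a) ` {0..card A}) < card {0..card A}"
    using card_mono[OF A(1)] by (metis card_atLeastAtMost diff_zero le_imp_less_Suc)
  then have "\<not> inj_on (\<lambda>k. (\<sigma> ^^ k) a) {0..card A}" by (rule pigeonhole)
  then obtain i j where ij: "i < j" "j \<le> card A" "(\<sigma> ^^ i) a = (\<sigma> ^^ j) a"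
    unfolding inj_on_def by (metis atLeastAtMost_iff linorder_neqE_nat)
  have "(\<sigma> ^^ i) ((\<sigma> ^^ (j - i)) a) = (\<sigma> ^^ i) a"
    using ij by (metis funpow_add le_add_diff_inverse less_imp_le o_apply)
  then have fixed: "(\<sigma> ^^ (j - i)) a = a"
    using bij_is_inj[OF bij_betw_funpow[OF \<sigma>], of i] by (simp add: inj_eq)
  have "j - i dvd fact (card A)" using ij by (intro dvd_fact) auto
  then obtain q where "fact (card A) = (j - i) * q" by (elim dvdE)
  moreover have "((\<sigma> ^^ (j - i)) ^^ q) a = a" by (induction q) (use fixed in auto)
  ultimately show ?thesis by (simp add: funpow_mult)
qed

section \<open>The linear automorphism group\<close>

definition curve :: "('k::field ^ 'n) set set" where
  "curve = {P \<in> PG UNIV. P \<subseteq> curve_cone}"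

text \<open>Restricted to \<open>curve\<close> because the elements of \<open>Bij\<close> are
  extensional.\<close>

definition perm_action :: "('n::finite option \<Rightarrow> 'n option) \<Rightarrow> ('k::field ^ 'n) set \<Rightarrow> ('k ^ 'n) set" where
  "perm_action \<sigma> = (\<lambda>P\<in>curve. perm_map \<sigma> ` P)"

lemma image_span_singleton:
  "Vector_Spaces.linear (*s) (*s) f \<Longrightarrow> f ` vec.span {x} = vec.span {f x}" for f :: "'k::field ^ 'n \<Rightarrow> 'k ^ 'n"
  by (auto simp: vec.span_singleton vec.linear_scale image_image)

lemma curve_cone_scale: "x \<in> curve_cone \<Longrightarrow> c *s x \<in> curve_cone"
  by (simp add: curve_cone_def power_mult_distrib flip: sum_distrib_left)

lemma zero_in_curve_cone: "0 \<in> curve_cone"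
  by (simp add: curve_cone_def zero_power)

lemma span_in_curve: "x \<in> curve_cone \<Longrightarrow> x \<noteq> 0 \<Longrightarrow> vec.span {x} \<in> curve" for x :: "'k::field ^ 'n"
  by (auto simp: curve_def PG_def vec.span_singleton curve_cone_scale)

lemma curveE:
  fixes P :: "('k::field ^ 'n) set"
  assumes "P \<in> curve"
  obtains x where "x \<in> curve_cone" "x \<noteq> 0" "P = vec.span {x}"
  using assms unfolding curve_def PG_def by (blast intro: vec.span_base)

lemma curve_subset_PG: "curve \<subseteq> PG UNIV"
  by (auto simp: curve_def)

lemma curve_subset_PG_sum_zero:
  assumes "CARD('n) \<ge> 3"
  shows "(curve :: ('k::field ^ 'n) set set) \<subseteq> PG sum_zero"
proof
  fix P :: "('k ^ 'n) set" assume "P \<in> curve"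
  then obtain x where "x \<in> curve_cone" "x \<noteq> 0" "P = vec.span {x}" by (rule curveE)
  then show "P \<in> PG sum_zero" unfolding PG_def using curve_cone_sum_zero[OF assms] by blast
qed

lemma subspace_sum_zero: "vec.subspace (sum_zero :: ('k::field ^ 'n) set)"
  by (simp add: vec.subspace_def sum_zero_def sum.distrib flip: sum_distrib_left)

section \<open>Permutations as linear automorphisms when \<open>CARD('n) + 1\<close> vanishes in the
  field\<close>

context
  assumes p: "(of_nat (CARD('n::finite) + 1) :: 'k::field) = 0"
begin

lemma perm_map_curve:
  fixes P :: "('k ^ 'n) set"
  assumes \<sigma>: "bij \<sigma>" and P: "P \<in> curve"
  shows "perm_map \<sigma> ` P \<in> curve"
proof -
  obtain x where x: "x \<in> curve_cone" "x \<noteq> 0" "P = vec.span {x}" using P by (rule curveE)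
  have "perm_map \<sigma> x \<noteq> 0"
    using x(2) perm_map_inv(2)[OF \<sigma>] vec.linear_0[OF linear_perm_map] by metis
  then show ?thesis
    using span_in_curve[OF perm_map_curve_cone[OF \<sigma> p x(1)]] image_span_singleton[OF linear_perm_map, of \<sigma> x]
    by (simp add: x(3))
qed

lemma perm_action_inverse:
  assumes "bij \<sigma>" "P \<in> (curve :: ('k ^ 'n) set set)"
  shows "perm_action \<sigma> (perm_action (inv' \<sigma>) P) = P" "perm_action (inv' \<sigma>) (perm_action \<sigma> P) = P"
  using assms perm_map_curve[OF _ assms(2)]
  by (simp_all add: perm_action_def bij_imp_bij_inv image_image perm_map_inv)

lemma perm_action_in_curve: "bij \<sigma> \<Longrightarrow> P \<in> curve \<Longrightarrow> perm_action \<sigma> P \<in> (curve :: ('k ^ 'n) set set)"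
  by (simp add: perm_action_def perm_map_curve)

lemma perm_action_bij_betw:
  "bij \<sigma> \<Longrightarrow> bij_betw (perm_action \<sigma>) curve (curve :: ('k ^ 'n) set set)"
  by (rule bij_betw_byWitness[where f' = "perm_action (inv' \<sigma>)"])
     (auto simp: perm_action_inverse perm_action_in_curve bij_imp_bij_inv)

lemma perm_action_Bij: "bij \<sigma> \<Longrightarrow> perm_action \<sigma> \<in> Bij (curve :: ('k ^ 'n) set set)"
  using perm_action_bij_betw by (simp add: Bij_def) (simp add: perm_action_def)

lemma form_perm_map: "form 1 (\<lambda>x :: 'k ^ 'n. perm_map \<sigma> x $ j)"
proof -
  have neg: "form 1 (\<lambda>x. - g x)" if "form 1 g" for g :: "'k ^ 'n \<Rightarrow> 'k"
    using form.mult[OF form.const[of "-1"] that] by simp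
  have "form 1 (\<lambda>x :: 'k ^ 'n. translate x 0 $ a)" for a
  proof (cases a)
    case None
    fix i
    have "form (0 + 1) (\<lambda>x :: 'k ^ 'n. 0 * x $ i)" by (intro form.intros)
    then show ?thesis by (simp add: None)
  next
    case (Some i)
    then show ?thesis using form.coord[of i] by simp
  qed
  from form.add[OF this neg[OF this]] show ?thesis by (simp add: perm_map_nth)
qed

lemma regular_map_perm_action:
  assumes \<sigma>: "bij \<sigma>"
  shows "regular_map (curve :: ('k ^ 'n) set set) (perm_action \<sigma>)"
  unfolding regular_map_def
proof (intro conjI ballI)
  show "perm_action \<sigma> \<in> curve \<rightarrow> (curve :: ('k ^ 'n) set set)"
    using perm_action_in_curve[OF \<sigma>] by blast
  fix P :: "('k ^ 'n) set" assume P: "P \<in> curve"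
  have nz: "v \<noteq> 0" if "perm_map \<sigma> v \<noteq> 0" for v :: "'k ^ 'n"
    using that vec.linear_0[OF linear_perm_map] by metis
  show "\<exists>d F. (\<forall>i. form d (\<lambda>x. F x $ i)) \<and> (\<exists>v\<in>P. F v \<noteq> 0) \<and>
        (\<forall>Q\<in>curve. \<forall>v\<in>Q. F v \<noteq> 0 \<longrightarrow> perm_action \<sigma> Q = vec.span {F v})"
  proof (intro exI[of _ 1] exI[of _ "perm_map \<sigma>"] conjI allI ballI impI)
    obtain x where "x \<noteq> 0" "P = vec.span {x}" using P by (rule curveE)
    moreover from this have "perm_map \<sigma> x \<noteq> 0"
      using perm_map_inv(2)[OF \<sigma>] vec.linear_0[OF linear_perm_map] by metis
    ultimately show "\<exists>v\<in>P. perm_map \<sigma> v \<noteq> 0" by (blast intro: vec.span_base)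
    show "perm_action \<sigma> Q = vec.span {perm_map \<sigma> v}"
      if "Q \<in> curve" "v \<in> Q" "perm_map \<sigma> v \<noteq> 0" for Q and v :: "'k ^ 'n"
      using that in_PG_span[OF subsetD[OF curve_subset_PG that(1)] that(2) nz[OF that(3)]]
      by (simp add: perm_action_def image_span_singleton[OF linear_perm_map])
  qed (rule form_perm_map)
qed

lemma perm_action_LAut:
  assumes \<sigma>: "bij \<sigma>" and card: "CARD('n) \<ge> 3"
  shows "perm_action \<sigma> \<in> carrier (LAut sum_zero (curve :: ('k ^ 'n) set set))"
proof -
  have inv: "bij (inv' \<sigma>)" using \<sigma> by (rule bij_imp_bij_inv)
  have "inv_into curve (perm_action \<sigma>) P = perm_action (inv' \<sigma>) P" if P: "P \<in> (curve :: ('k ^ 'n) set set)" for P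
    using perm_action_bij_betw[OF \<sigma>] P
    by (intro inv_into_f_eq) (auto simp: bij_betw_def perm_action_in_curve[OF inv] perm_action_inverse[OF \<sigma>])
  then have "regular_map curve (inv_into (curve :: ('k ^ 'n) set set) (perm_action \<sigma>))"
    using regular_map_cong[of curve "inv_into curve (perm_action \<sigma>)"] regular_map_perm_action[OF inv] by blast
  then have Aut: "perm_action \<sigma> \<in> carrier (Aut (curve :: ('k ^ 'n) set set))"
    using regular_map_perm_action[OF \<sigma>] perm_action_Bij[OF \<sigma>] by (simp add: Aut_def)
  have "bij_betw (perm_map \<sigma>) sum_zero (sum_zero :: ('k ^ 'n) set)"
    by (rule bij_betw_byWitness[where f' = "perm_map (inv' \<sigma>)"])
       (auto simp: perm_map_inv[OF \<sigma>] perm_map_sum_zero[OF \<sigma> p] perm_map_sum_zero[OF inv p])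
  then have "(\<lambda>P\<in>PG sum_zero. perm_map \<sigma> ` P) \<in> projectivities (sum_zero :: ('k ^ 'n) set)"
    unfolding projectivities_def using linear_perm_map by blast
  moreover have "perm_action \<sigma> P = (\<lambda>P\<in>PG sum_zero. perm_map \<sigma> ` P) P" if "P \<in> (curve :: ('k ^ 'n) set set)" for P
    using that curve_subset_PG_sum_zero[OF card] by (auto simp: perm_action_def)
  ultimately have "\<exists>g\<in>projectivities sum_zero. \<forall>P\<in>(curve :: ('k ^ 'n) set set). perm_action \<sigma> P = g P"
    by (intro bexI[where x = "\<lambda>P\<in>PG sum_zero. perm_map \<sigma> ` P"] ballI)
  with Aut show ?thesis by (simp add: LAut_def)
qed

lemma perm_action_compose:
  assumes "bij \<sigma>" "bij \<tau>"
  shows "compose curve (perm_action \<sigma>) (perm_action \<tau>)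
    = (perm_action (\<sigma> \<circ> \<tau>) :: ('k ^ 'n) set \<Rightarrow> ('k ^ 'n) set)"
proof
  fix P :: "('k ^ 'n) set"
  show "compose curve (perm_action \<sigma>) (perm_action \<tau>) P = perm_action (\<sigma> \<circ> \<tau>) P"
    using assms perm_map_curve[OF assms(2), of P]
    by (cases "P \<in> curve") (simp_all add: compose_def perm_action_def image_image perm_map_compose)
qed

end

section \<open>From linear automorphisms back to permutations\<close>

lemma LAut_perm_map:
  fixes \<phi> :: "('k::alg_closed_field ^ 'n) set \<Rightarrow> ('k ^ 'n) set"
  assumes \<phi>: "\<phi> \<in> carrier (LAut sum_zero curve)"
    and card: "CARD('n) \<ge> 5" and char: "(of_nat (CARD('n) - 1) :: 'k) \<noteq> 0"
    and nz: "(of_nat CARD('n) :: 'k) \<noteq> 0"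
    and two: "(2::'k) \<noteq> 0" and three: "(3::'k) \<noteq> 0"
  obtains \<sigma> where "bij \<sigma>" "\<sigma> None = None \<or> (of_nat (CARD('n) + 1) :: 'k) = 0"
    "\<And>P. P \<in> curve \<Longrightarrow> \<phi> P = perm_map \<sigma> ` P"
proof -
  have card3: "CARD('n) \<ge> 3" using card by simp
  have \<phi>_bij: "bij_betw \<phi> curve curve" using \<phi> by (auto simp: LAut_def Aut_def Bij_def)
  obtain g where g: "g \<in> projectivities sum_zero" "\<And>P. P \<in> curve \<Longrightarrow> \<phi> P = g P"
    using \<phi> by (auto simp: LAut_def)
  obtain f where f: "Vector_Spaces.linear (*s) (*s) f" "bij_betw f sum_zero sum_zero"
    and g_f: "g = (\<lambda>P\<in>PG sum_zero. f ` P)"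
    using g(1) unfolding projectivities_def by blast
  have \<phi>_f: "\<phi> P = f ` P" if "P \<in> curve" for P
    using g(2)[OF that] subsetD[OF curve_subset_PG_sum_zero[OF card3] that] by (simp add: g_f)
  obtain h where h: "Vector_Spaces.linear (*s) (*s) h" "bij_betw h sum_zero sum_zero"
    and hf: "\<And>x. x \<in> sum_zero \<Longrightarrow> h (f x) = x"
    by (rule bij_betw_linear_inverse[OF subspace_sum_zero f]) (rule that)
  \<comment> \<open>As \<open>\<phi>\<close> maps onto the curve, \<open>x\<close> is the image
    under \<open>f\<close> of a vector in the cone, and \<open>h\<close> returns that
    vector.\<close>
  have "h x \<in> curve_cone" if x: "x \<in> curve_cone" for x
  proof (cases "x = 0")
    case True
    then show ?thesis using zero_in_curve_cone vec.linear_0[OF h(1)] by simp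
  next
    case False
    have "vec.span {x} \<in> \<phi> ` curve"
      using span_in_curve[OF x False] \<phi>_bij by (simp add: bij_betw_def)
    then obtain Q where Q: "Q \<in> curve" "\<phi> Q = vec.span {x}" by blast
    have "x \<in> f ` Q" using Q \<phi>_f vec.span_base[of x "{x}"] by auto
    then obtain y where y: "y \<in> Q" "x = f y" by blast
    have "y \<in> curve_cone" using Q(1) y(1) by (auto simp: curve_def)
    then show ?thesis using hf[OF curve_cone_sum_zero[OF card3]] y(2) by simp
  qed
  then have cone: "h ` curve_cone \<subseteq> curve_cone" by blast
  obtain c \<sigma> where c: "c \<noteq> 0" and \<sigma>: "bij \<sigma>" "\<sigma> None = None \<or> (of_nat (CARD('n) + 1) :: 'k) = 0"
    and f_eq: "\<And>x. x \<in> sum_zero \<Longrightarrow> f x = c *s perm_map \<sigma> x"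
    by (rule cone_map_is_permutation[OF f(1) h(1) cone _ h(2) _ card char nz two three],
        erule bij_betwE[OF f(2), rule_format], erule hf, rule that)
  have "\<phi> P = perm_map \<sigma> ` P" if P: "P \<in> curve" for P
  proof -
    obtain x where x: "x \<in> curve_cone" "P = vec.span {x}" using P by (rule curveE)
    have "\<phi> P = vec.span {c *s perm_map \<sigma> x}"
      using \<phi>_f[OF P] image_span_singleton[OF f(1)] f_eq[OF curve_cone_sum_zero[OF card3 x(1)]] x(2) by simp
    \<comment> \<open>The scalar \<open>c\<close> disappears projectively.\<close>
    also have "\<dots> = vec.span {perm_map \<sigma> x}" 
      using c vec.span_image_scale[of "{perm_map \<sigma> x}" "\<lambda>_. c"] by simp
    finally show ?thesis by (simp add: x(2) image_span_singleton[OF linear_perm_map])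
  qed
  with \<sigma> show thesis by (rule that)
qed

lemma Aut_mult:
  "\<phi> \<in> carrier (Aut V) \<Longrightarrow> \<psi> \<in> carrier (Aut V) \<Longrightarrow> \<phi> \<otimes>\<^bsub>Aut V\<^esub> \<psi> = compose V \<phi> \<psi>"
  by (simp add: Aut_def BijGroup_def)

lemma Aut_one: "\<one>\<^bsub>Aut V\<^esub> = (\<lambda>P\<in>V. P)"
  by (simp add: Aut_def BijGroup_def)

lemma Aut_pow_perm_map:
  fixes \<phi> :: "('k::field ^ 'n) set \<Rightarrow> ('k ^ 'n) set"
  assumes \<phi>: "\<phi> \<in> carrier (Aut curve)" and \<sigma>: "bij \<sigma>"
    and eq: "\<And>P. P \<in> curve \<Longrightarrow> \<phi> P = perm_map \<sigma> ` P" and P: "P \<in> curve"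
  shows "(\<phi> [^]\<^bsub>Aut curve\<^esub> (k::nat)) P = perm_map (\<sigma> ^^ k) ` P"
  using P
proof (induction k arbitrary: P)
  case 0
  then show ?case by (simp add: Aut_one perm_map_id flip: id_def)
next
  case (Suc k)
  interpret A: group "Aut (curve :: ('k ^ 'n) set set)" by (rule group_Aut[OF curve_subset_PG])
  have \<phi>P: "\<phi> P \<in> curve" using \<phi> Suc.prems Bij_imp_funcset[of \<phi> curve] by (auto simp: Aut_def)
  have "(\<phi> [^]\<^bsub>Aut curve\<^esub> Suc k) P = (\<phi> [^]\<^bsub>Aut curve\<^esub> k) (\<phi> P)"
    using \<phi> Suc.prems by (simp add: Aut_mult compose_def)
  also have "\<dots> = perm_map (\<sigma> ^^ k) ` perm_map \<sigma> ` P"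
    using Suc.IH[OF \<phi>P] eq[OF Suc.prems] by simp
  also have "\<dots> = perm_map (\<sigma> ^^ Suc k) ` P"
    by (simp add: image_image perm_map_compose bij_betw_funpow \<sigma> funpow_Suc_right del: funpow.simps)
  finally show ?case .
qed

text \<open>If \<open>CARD('n) + 1\<close> were nonzero, the permutation would fix
  \<open>None\<close> and only permute the original coordinates. The order of \<open>\<phi>\<close>
  would then divide the factorial of \<open>CARD('n)\<close>, which the larger prime
  \<open>p\<close> does not divide.\<close>

lemma nontame_LAut:
  fixes \<phi> :: "('k::alg_closed_field ^ 'n) set \<Rightarrow> ('k ^ 'n) set"
  assumes \<phi>: "\<phi> \<in> carrier (LAut sum_zero curve)" and nontame: "nontame p (Aut curve) \<phi>"
    and p: "prime p" "CARD('n) < p"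
    and card: "CARD('n) \<ge> 5" and char: "(of_nat (CARD('n) - 1) :: 'k) \<noteq> 0"
    and nz: "(of_nat CARD('n) :: 'k) \<noteq> 0"
    and two: "(2::'k) \<noteq> 0" and three: "(3::'k) \<noteq> 0"
  shows "(of_nat (CARD('n) + 1) :: 'k) = 0"
proof (rule ccontr)
  assume neq: "(of_nat (CARD('n) + 1) :: 'k) \<noteq> 0"
  interpret A: group "Aut (curve :: ('k ^ 'n) set set)" by (rule group_Aut[OF curve_subset_PG])
  have \<phi>_Aut: "\<phi> \<in> carrier (Aut curve)" using \<phi> by (simp add: LAut_def)
  obtain \<sigma> where \<sigma>: "bij \<sigma>" "\<sigma> None = None" and eq: "\<And>P. P \<in> curve \<Longrightarrow> \<phi> P = perm_map \<sigma> ` P"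
    using LAut_perm_map[OF \<phi> card char nz two three] neq by metis
  let ?N = "fact CARD('n) :: nat"
  have "(\<sigma> ^^ ?N) a = a" for a
  proof (cases a)
    case None
    have "(\<sigma> ^^ k) None = None" for k by (induction k) (simp_all add: \<sigma>(2))
    then show ?thesis by (simp add: None)
  next
    case (Some i)
    have "\<sigma> (Some i) \<in> range Some" for i
      using \<sigma> by (metis bij_is_inj inj_eq option.distinct(1) option.exhaust rangeI)
    then have "(\<sigma> ^^ fact (card (range (Some :: 'n \<Rightarrow> 'n option)))) (Some i) = Some i"
      by (intro funpow_fact_fixes[OF \<sigma>(1)]) auto
    then show ?thesis by (simp add: Some card_image)
  qed
  then have pow: "\<sigma> ^^ ?N = id" by auto
  have "(\<phi> [^]\<^bsub>Aut curve\<^esub> ?N) P = P" if "P \<in> curve" for P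
    using Aut_pow_perm_map[OF \<phi>_Aut \<sigma>(1) eq that, of ?N] by (simp add: pow perm_map_id)
  moreover have "\<phi> [^]\<^bsub>Aut curve\<^esub> ?N \<in> extensional curve"
    using A.nat_pow_closed[OF \<phi>_Aut, of ?N] by (simp add: Aut_def Bij_def)
  ultimately have "\<phi> [^]\<^bsub>Aut curve\<^esub> ?N = \<one>\<^bsub>Aut curve\<^esub>"
    unfolding Aut_one by (intro extensionalityI[of _ curve]) auto
  then have "group.ord (Aut curve) \<phi> dvd ?N" using A.pow_eq_id[OF \<phi>_Aut] by blast
  moreover have "p dvd group.ord (Aut curve) \<phi>"
    using nontame A.generate_pow_card[OF \<phi>_Aut] by (simp add: nontame_def)
  ultimately have "p dvd ?N" by (rule dvd_trans[rotated])
  then show False using p by (simp add: prime_dvd_fact_iff)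
qed

section \<open>Faithfulness of the action and the isomorphism with the symmetric group\<close>

lemma perm_action_inj:
  assumes card: "CARD('n) \<ge> 5" and char: "(of_nat (CARD('n::finite) - 1) :: 'k::alg_closed_field) \<noteq> 0"
    and p: "(of_nat (CARD('n) + 1) :: 'k) = 0" and bij: "bij \<sigma>" "bij \<tau>"
    and eq: "(perm_action \<sigma> :: ('k ^ 'n) set \<Rightarrow> ('k ^ 'n) set) = perm_action \<tau>"
  shows "\<sigma> = \<tau>"
proof -
  have inv: "bij (inv' \<tau>)" using bij(2) by (rule bij_imp_bij_inv)
  have "inv' \<tau> \<circ> \<sigma> = id"
  proof (rule perm_map_projectively_trivial[OF bij_comp[OF bij(1) inv] card char])
    fix x :: "'k ^ 'n" assume "x \<in> distinct_cone"
    then have x: "x \<in> curve_cone" by (simp add: distinct_cone_def)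
    show "\<exists>c. perm_map (inv' \<tau> \<circ> \<sigma>) x = c *s x"
    proof (cases "x = 0")
      case True
      then show ?thesis using vec.linear_0[OF linear_perm_map] by auto
    next
      case False
      let ?P = "vec.span {x}"
      have P: "?P \<in> curve" by (rule span_in_curve[OF x False])
      have "perm_map (inv' \<tau> \<circ> \<sigma>) ` ?P = perm_map (inv' \<tau>) ` perm_map \<sigma> ` ?P"
        by (simp add: image_image perm_map_compose[OF inv bij(1)])
      also have "perm_map \<sigma> ` ?P = perm_map \<tau> ` ?P"
        using fun_cong[OF eq, of ?P] P by (simp add: perm_action_def)
      also have "perm_map (inv' \<tau>) ` perm_map \<tau> ` ?P = ?P"
        by (simp add: image_image perm_map_inv[OF bij(2)])
      finally have "perm_map (inv' \<tau> \<circ> \<sigma>) x \<in> ?P" using vec.span_base[of x "{x}"] by blast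
      then show ?thesis by (auto simp: vec.span_singleton)
    qed
  qed
  then have "\<tau> \<circ> (inv' \<tau> \<circ> \<sigma>) = \<tau>" by simp
  then show ?thesis using bij(2) by (simp add: comp_assoc[symmetric] surj_iff[THEN iffD1] bij_is_surj)
qed

lemma LAut_iso_sym_group:
  assumes card: "CARD('n) \<ge> 5" and char: "(of_nat (CARD('n::finite) - 1) :: 'k::alg_closed_field) \<noteq> 0"
    and nz: "(of_nat CARD('n) :: 'k) \<noteq> 0" and p: "(of_nat (CARD('n) + 1) :: 'k) = 0"
    and two: "(2::'k) \<noteq> 0" and three: "(3::'k) \<noteq> 0"
  shows "LAut sum_zero (curve :: ('k ^ 'n) set set) \<cong> sym_group (CARD('n) + 1)"
proof -
  let ?A = "{1..CARD('n) + 1}" and ?L = "LAut sum_zero (curve :: ('k ^ 'n) set set)"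
  have card3: "CARD('n) \<ge> 3" using card by simp
  obtain e where e: "bij_betw e ?A (UNIV :: 'n option set)"
    using finite_same_card_bij[of ?A "UNIV :: 'n option set"] by (auto simp: card_UNIV_option)
  \<comment> \<open>Conjugation by the numbering \<open>e\<close> turns permutations of the numbers
    up to \<open>CARD('n) + 1\<close> into bijections of \<open>'n option\<close>.\<close>
  define conj where "conj s a = e (s (inv_into ?A e a))" for s a
  have conj: "bij_betw conj {s. s permutes ?A} {\<sigma>. bij \<sigma>}"
  proof -
    have "s permutes UNIV \<longleftrightarrow> bij s" for s :: "'n option \<Rightarrow> 'n option"
      using permutes_bij bij_imp_permutes by blast
    then show ?thesis using bij_betw_permutations[OF e] by (simp add: conj_def[abs_def])
  qed
  have conj_comp: "conj (s \<circ> t) = conj s \<circ> conj t" if "t permutes ?A" for s t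
  proof
    fix a
    have "inv_into ?A e a \<in> ?A" using bij_betw_imp_surj_on[OF e] by (metis UNIV_I inv_into_into)
    then have "t (inv_into ?A e a) \<in> ?A" using permutes_in_image[OF that] by blast
    then show "conj (s \<circ> t) a = (conj s \<circ> conj t) a"
      using bij_betw_inv_into_left[OF e] by (simp add: conj_def)
  qed
  have act: "bij_betw perm_action {\<sigma> :: 'n option \<Rightarrow> 'n option. bij \<sigma>} (carrier ?L)"
  proof (rule bij_betw_imageI)
    show "inj_on (perm_action :: _ \<Rightarrow> ('k ^ 'n) set \<Rightarrow> _) {\<sigma>. bij \<sigma>}"
      using perm_action_inj[OF card char p] by (auto intro!: inj_onI)
    show "perm_action ` {\<sigma> :: 'n option \<Rightarrow> 'n option. bij \<sigma>} = carrier ?L"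
    proof
      show "perm_action ` {\<sigma> :: 'n option \<Rightarrow> 'n option. bij \<sigma>} \<subseteq> carrier ?L"
        using perm_action_LAut[OF p _ card3] by blast
      show "carrier ?L \<subseteq> perm_action ` {\<sigma> :: 'n option \<Rightarrow> 'n option. bij \<sigma>}"
      proof
        fix \<phi> assume \<phi>: "\<phi> \<in> carrier ?L"
        obtain \<sigma> where \<sigma>: "bij \<sigma>" and eq: "\<And>P. P \<in> curve \<Longrightarrow> \<phi> P = perm_map \<sigma> ` P"
          by (rule LAut_perm_map[OF \<phi> card char nz two three]) (rule that)
        have "\<phi> \<in> extensional curve" using \<phi> by (simp add: LAut_def Aut_def Bij_def)
        then have "\<phi> = perm_action \<sigma>"
          unfolding perm_action_def by (intro extensionalityI[of _ curve]) (auto simp: eq)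
        with \<sigma> show "\<phi> \<in> perm_action ` {\<sigma>. bij \<sigma>}" by blast
      qed
    qed
  qed
  have bij_conj: "bij (conj s)" if "s permutes ?A" for s
    using bij_betwE[OF conj] that by blast
  have "(\<lambda>s. perm_action (conj s)) \<in> iso (sym_group (CARD('n) + 1)) ?L"
  proof (rule isoI)
    show "(\<lambda>s. perm_action (conj s)) \<in> hom (sym_group (CARD('n) + 1)) ?L"
    proof (rule homI)
      fix s t assume st: "s \<in> carrier (sym_group (CARD('n) + 1))" "t \<in> carrier (sym_group (CARD('n) + 1))"
      then have b: "bij (conj s)" "bij (conj t)" by (simp_all add: bij_conj sym_group_carrier)
      then have "perm_action (conj s) \<in> carrier ?L" "perm_action (conj t) \<in> carrier ?L"
        using perm_action_LAut[OF p _ card3] by blast+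
      then have "perm_action (conj s) \<otimes>\<^bsub>?L\<^esub> perm_action (conj t)
          = compose curve (perm_action (conj s)) (perm_action (conj t))"
        using Aut_mult by (auto simp: LAut_def)
      then show "perm_action (conj (s \<otimes>\<^bsub>sym_group (CARD('n) + 1)\<^esub> t)) = perm_action (conj s) \<otimes>\<^bsub>?L\<^esub> perm_action (conj t)"
        using perm_action_compose[OF p b] conj_comp[of t s] st by (simp add: sym_group_mult sym_group_carrier)
    qed (use perm_action_LAut[OF p _ card3] bij_conj sym_group_carrier in blast)
    have "carrier (sym_group (CARD('n) + 1)) = {s. s permutes ?A}" by (auto simp: sym_group_carrier)
    then show "bij_betw (\<lambda>s. perm_action (conj s)) (carrier (sym_group (CARD('n) + 1))) (carrier ?L)"
      using bij_betw_trans[OF conj act] by (simp add: o_def)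
  qed
  then have "sym_group (CARD('n) + 1) \<cong> ?L" by (rule is_isoI)
  then show ?thesis by (rule group.iso_sym[OF sym_group_is_group])
qed

theorem theorem7p2:
  fixes p m :: nat
    and H :: "('k::alg_closed_field ^ 'n) set"
    and V :: "('k ^ 'n) set set"
  assumes "prime p" and "CHAR('k) = p" and "p \<ge> 7"
    and "CARD('n) = m" and "5 \<le> m" and "m \<le> p - 1"
    and "H = {x. (\<Sum>i\<in>UNIV. x $ i) = 0}"
    and "V = {P \<in> PG UNIV. \<forall>x\<in>P. \<forall>k\<in>{1..m - 2}. (\<Sum>i\<in>UNIV. (x $ i) ^ k) = 0}"
    and "\<exists>\<phi>\<in>carrier (LAut H V). nontame p (Aut V) \<phi>"
  shows "m = p - 1 \<and> LAut H V \<cong> sym_group p"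
proof -
  have H: "H = sum_zero" using assms(7) by (simp add: sum_zero_def)
  have V: "V = curve" using assms(4,8) by (auto simp: curve_def curve_cone_def)
  have nz: "(of_nat k :: 'k) \<noteq> 0" if "0 < k" "k < p" for k
    using that assms(2) by (auto simp: of_nat_eq_0_iff_char_dvd dest: dvd_imp_le)
  have two: "(2::'k) \<noteq> 0" and three: "(3::'k) \<noteq> 0"
    using nz[of 2] nz[of 3] assms(3) by simp_all
  have card: "CARD('n) \<ge> 5" "CARD('n) < p" using assms(4-6) by auto
  have char: "(of_nat (CARD('n) - 1) :: 'k) \<noteq> 0" "(of_nat CARD('n) :: 'k) \<noteq> 0"
    by (rule nz; use card in simp)+
  obtain \<phi> where "\<phi> \<in> carrier (LAut sum_zero curve)" "nontame p (Aut (curve :: ('k ^ 'n) set set)) \<phi>"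
    using assms(9) unfolding H V by blast
  from nontame_LAut[OF this assms(1) card(2,1) char two three]
  have zero: "(of_nat (CARD('n) + 1) :: 'k) = 0" .
  \<comment> \<open>The characteristic divides this positive number, which is also at most
    \<open>p\<close>.\<close>
  then have "p \<le> CARD('n) + 1" using assms(2) by (auto simp: of_nat_eq_0_iff_char_dvd simp del: of_nat_add of_nat_Suc dest: dvd_imp_le)
  then have m: "CARD('n) + 1 = p" using card by simp
  then show ?thesis
    using LAut_iso_sym_group[OF card(1) char zero two three] assms(4) by (simp add: H V)
qed

end
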